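(* Let $D$ be the space-time dimension, let $\mathcal A$ be the free graded-commutative (polynomial) algebra generated by the mixed-symmetry field $T_{[ab]c}$, the ghosts $S_{ab}$ and $A_{ab}$, the ghosts of ghosts $C_a$, the antifields $T^{*[ab]c}, T^{*bc}, T^{*c}$, and all the partial derivatives of these, and let $\gamma$ be the longitudinal exterior derivative on $\mathcal A$ (all as defined in the context). Then the cohomology $H(\gamma)=\operatorname{Ker}\gamma/\operatorname{Im}\gamma$ of $\gamma$ in $\mathcal A$ is generated by the variables $$C_a,\qquad F^A_{abc},\qquad E^T_{abcd_1\ldots d_k}\ (k\ge 2),$$ together with the antifields and all derivatives of the antifields. That is, all these variables are $\gamma$-closed, and the inclusion into $\mathcal A$ of the subalgebra of polynomials in these variables induces an isomorphism from this subalgebra onto $H(\gamma)$.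
   Context: Indices $a,b,c,d_i,\ldots$ run over $D$ values; $\partial_a$ are commuting partial derivatives, and $\partial_{d_1\ldots d_k}=\partial_{d_1}\cdots\partial_{d_k}$. Everything is algebraic: each field below, together with all its formal derivatives $\partial_{d_1\ldots d_k}(\cdot)$ (symmetric in $d_1,\ldots,d_k$), gives independent generators, subject only to the stated index symmetries. Polynomials have constant real coefficients. Generators and their index symmetries: - Field $T_{[ab]c}$ with $T_{[ab]c}=-T_{[ba]c}$ and $T_{[ab]c}+T_{[ca]b}+T_{[bc]a}=0$; pureghost number $0$, commuting. - Ghosts $S_{ab}=S_{ba}$ and $A_{ab}=-A_{ba}$; pureghost number $1$, anticommuting. - Ghosts of ghosts $C_a$; pureghost number $2$, commuting. - Antifields $T^{*[ab]c}$ (same index symmetries as $T_{[ab]c}$), $T^{*bc}$ (no index symmetry), $T^{*c}$, of antighost number $1,2,3$ and Grassmann parity odd, even, odd respectively. The longitudinal exterior derivative $\gamma$ is the odd (graded) derivation of $\mathcal A$ which commutes with all $\partial_a$ and acts by $$\gamma T_{[ab]c}=\partial_a S_{bc}-\partial_b S_{ac}+\partial_a A_{bc}-\partial_b A_{ac}-2\partial_c A_{ab},$$ $$\gamma S_{ab}=3(\partial_a C_b+\partial_b C_a),\qquad \gamma A_{ab}=\partial_a C_b-\partial_b C_a,\qquad \gamma C_a=0,$$ $$\gamma(\text{antifields})=0 .$$ It satisfies $\gamma^2=0$. $F^A_{abc}$ is the total antisymmetrization of $\partial_c A_{ab}$: $F^A_{abc}=\frac13(\partial_c A_{ab}+\partial_a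 A_{bc}+\partial_b A_{ca})$. For $k\ge 2$, $E^T_{abcd_1\ldots d_k}$ is the component of $\partial_{d_1\ldots d_k}T_{[ab]c}$ associated with the Young tableau of shape $(k,2,1)$ whose first row is $a,c,d_1,\ldots,d_{k-2}$, second row is $b,d_{k-1}$, and third row is $d_k$. It is obtained by first symmetrizing $\partial_{d_1\ldots d_k}T_{[ab]c}$ over the indices in each row, and then antisymmetrizing the result over the indices in each column (columns $\{a,b,d_k\}$ and $\{c,d_{k-1}\}$, the other columns having one box), each (anti)symmetrization over $n$ indices being normalized by $1/n!$. "Polynomials in these variables" means the subalgebra of $\mathcal A$ generated by the linear span of the listed variables. *)

theory Defs
  imports
    "HOL-Library.Multiset"
    "HOL-Combinatorics.Permutations"
    "HOL-Algebra.QuotRing"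
    Complex_Main
begin

section \<open>Jet variables\<close>

text \<open>
  The type \<open>'n\<close> is the index set of the coordinates, so \<open>D = CARD('n)\<close> for a finite \<open>'n\<close>.
  A jet variable \<open>(f, M)\<close> stands for \<open>\<partial>_{d_1 ... d_k} f\<close>, where \<open>M\<close> is the multiset
  \<open>{d_1, ..., d_k}\<close>; multisets account for the symmetry in the derivative indices.
  The symmetries of the other indices are imposed below as relations.
\<close>

datatype 'n basic_field =
    FieldT 'n 'n 'n   \<comment> \<open>\<open>T_{[ab]c}\<close>\<close>
  | GhostS 'n 'n      \<comment> \<open>\<open>S_{ab}\<close>\<close>
  | GhostA 'n 'n      \<comment> \<open>\<open>A_{ab}\<close>\<close>
  | GhostC 'n         \<comment> \<open>\<open>C_a\<close>\<close>
  | Anti3 'n 'n 'n    \<comment> \<open>\<open>T^{*[ab]c}\<close>\<close>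
  | Anti2 'n 'n       \<comment> \<open>\<open>T^{*bc}\<close>\<close>
  | Anti1 'n          \<comment> \<open>\<open>T^{*c}\<close>\<close>

type_synonym 'n jet = "'n basic_field \<times> 'n multiset"

fun odd_field :: "'n basic_field \<Rightarrow> bool" where
  "odd_field (FieldT a b c) = False"
| "odd_field (GhostS a b) = True"
| "odd_field (GhostA a b) = True"
| "odd_field (GhostC a) = False"
| "odd_field (Anti3 a b c) = True"
| "odd_field (Anti2 b c) = False"
| "odd_field (Anti1 c) = True"

fun is_antifield :: "'n basic_field \<Rightarrow> bool" where
  "is_antifield (Anti3 a b c) = True"
| "is_antifield (Anti2 b c) = True"
| "is_antifield (Anti1 c) = True"
| "is_antifield _ = False"

definition parity_sign :: "'n jet \<Rightarrow> real" where
  "parity_sign g = (if odd_field (fst g) then -1 else 1)"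

definition koszul_sign :: "'n jet \<Rightarrow> 'n jet \<Rightarrow> real" where
  "koszul_sign g h = (if odd_field (fst g) \<and> odd_field (fst h) then -1 else 1)"


section \<open>The algebra as a presentation by generators and relations\<close>

datatype 'n expr =
    Var "'n jet"
  | Unit
  | Scale real "'n expr"
  | Plus "'n expr" "'n expr"
  | Times "'n expr" "'n expr"

inductive expr_eq :: "'n expr \<Rightarrow> 'n expr \<Rightarrow> bool"  (infix \<open>\<approx>\<close> 50) where
  \<comment> \<open>congruence\<close>
  refl: "x \<approx> x"
| sym: "x \<approx> y \<Longrightarrow> y \<approx> x"
| trans: "x \<approx> y \<Longrightarrow> y \<approx> z \<Longrightarrow> x \<approx> z"
| Scale_cong: "x \<approx> y \<Longrightarrow> Scale r x \<approx> Scale r y"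
| Plus_cong: "x \<approx> x' \<Longrightarrow> y \<approx> y' \<Longrightarrow> Plus x y \<approx> Plus x' y'"
| Times_cong: "x \<approx> x' \<Longrightarrow> y \<approx> y' \<Longrightarrow> Times x y \<approx> Times x' y'"
  \<comment> \<open>real vector space; the zero vector is \<open>Scale 0 Unit\<close>\<close>
| Plus_assoc: "Plus (Plus x y) z \<approx> Plus x (Plus y z)"
| Plus_comm: "Plus x y \<approx> Plus y x"
| Plus_zero: "Plus (Scale 0 Unit) x \<approx> x"
| Plus_minus: "Plus (Scale (-1) x) x \<approx> Scale 0 Unit"
| Scale_Plus: "Scale r (Plus x y) \<approx> Plus (Scale r x) (Scale r y)"
| Plus_Scale: "Scale (r + s) x \<approx> Plus (Scale r x) (Scale s x)"
| Scale_Scale: "Scale r (Scale s x) \<approx> Scale (r * s) x"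
| Scale_one: "Scale 1 x \<approx> x"
  \<comment> \<open>associative unital algebra\<close>
| Times_assoc: "Times (Times x y) z \<approx> Times x (Times y z)"
| Times_Unit_left: "Times Unit x \<approx> x"
| Times_Unit_right: "Times x Unit \<approx> x"
| Times_Plus_left: "Times (Plus x y) z \<approx> Plus (Times x z) (Times y z)"
| Times_Plus_right: "Times x (Plus y z) \<approx> Plus (Times x y) (Times x z)"
| Times_Scale_left: "Times (Scale r x) y \<approx> Scale r (Times x y)"
| Times_Scale_right: "Times x (Scale r y) \<approx> Scale r (Times x y)"
  \<comment> \<open>graded commutativity\<close>
| graded_comm: "Times (Var g) (Var h) \<approx> Scale (koszul_sign g h) (Times (Var h) (Var g))"
  \<comment> \<open>index symmetries\<close>
| T_antisym: "Var (FieldT a b c, M) \<approx> Scale (-1) (Var (FieldT b a c, M))"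
| T_cyclic: "Plus (Plus (Var (FieldT a b c, M)) (Var (FieldT c a b, M))) (Var (FieldT b c a, M))
    \<approx> Scale 0 Unit"
| S_sym: "Var (GhostS a b, M) \<approx> Var (GhostS b a, M)"
| A_antisym: "Var (GhostA a b, M) \<approx> Scale (-1) (Var (GhostA b a, M))"
| Anti3_antisym: "Var (Anti3 a b c, M) \<approx> Scale (-1) (Var (Anti3 b a c, M))"
| Anti3_cyclic: "Plus (Plus (Var (Anti3 a b c, M)) (Var (Anti3 c a b, M))) (Var (Anti3 b c a, M))
    \<approx> Scale 0 Unit"

quotient_type 'n jet_algebra = "'n expr" / expr_eq
  by (intro equivpI reflpI sympI transpI) (blast intro: expr_eq.intros)+


subsection \<open>Evaluation of expressions\<close>

definition index_symmetric :: "('n jet \<Rightarrow> 'b::real_vector) \<Rightarrow> bool" where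
  "index_symmetric v \<longleftrightarrow> (\<forall>a b c M.
      v (FieldT a b c, M) = - v (FieldT b a c, M) \<and>
      v (FieldT a b c, M) + v (FieldT c a b, M) + v (FieldT b c a, M) = 0 \<and>
      v (GhostS a b, M) = v (GhostS b a, M) \<and>
      v (GhostA a b, M) = - v (GhostA b a, M) \<and>
      v (Anti3 a b c, M) = - v (Anti3 b a c, M) \<and>
      v (Anti3 a b c, M) + v (Anti3 c a b, M) + v (Anti3 b c a, M) = 0)"

lemma index_symmetricD:
  assumes "index_symmetric v"
  shows "v (FieldT a b c, M) = - v (FieldT b a c, M)"
    and "v (FieldT a b c, M) + v (FieldT c a b, M) + v (FieldT b c a, M) = 0"
    and "v (GhostS a b, M) = v (GhostS b a, M)"
    and "v (GhostA a b, M) = - v (GhostA b a, M)"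
    and "v (Anti3 a b c, M) = - v (Anti3 b a c, M)"
    and "v (Anti3 a b c, M) + v (Anti3 c a b, M) + v (Anti3 b c a, M) = 0"
  by (insert assms, unfold index_symmetric_def, (elim allE conjE, assumption)+)

primrec hom_ext :: "('n jet \<Rightarrow> 'b::real_algebra_1) \<Rightarrow> 'n expr \<Rightarrow> 'b" where
  "hom_ext w (Var g) = w g"
| "hom_ext w Unit = 1"
| "hom_ext w (Scale r x) = r *\<^sub>R hom_ext w x"
| "hom_ext w (Plus x y) = hom_ext w x + hom_ext w y"
| "hom_ext w (Times x y) = hom_ext w x * hom_ext w y"

text \<open>
  The extension of \<open>v\<close> to sums and products by the twisted Leibniz rule
  \<open>\<delta>(x y) = \<delta> x u(y) + w(x) \<delta> y\<close>.
\<close>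

primrec leibniz_ext ::
    "('n jet \<Rightarrow> 'b::real_algebra_1) \<Rightarrow> ('n jet \<Rightarrow> 'b) \<Rightarrow> ('n jet \<Rightarrow> 'b) \<Rightarrow> 'n expr \<Rightarrow> 'b" where
  "leibniz_ext u w v (Var g) = v g"
| "leibniz_ext u w v Unit = 0"
| "leibniz_ext u w v (Scale r x) = r *\<^sub>R leibniz_ext u w v x"
| "leibniz_ext u w v (Plus x y) = leibniz_ext u w v x + leibniz_ext u w v y"
| "leibniz_ext u w v (Times x y) =
     leibniz_ext u w v x * hom_ext u y + hom_ext w x * leibniz_ext u w v y"

lemma hom_ext_cong:
  assumes "x \<approx> y" and sym: "index_symmetric w"
    and comm: "\<And>g h. w g * w h = koszul_sign g h *\<^sub>R (w h * w g)"
  shows "hom_ext w x = hom_ext w y"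
  using assms(1)
proof (induction rule: expr_eq.induct)
  case (graded_comm g h)
  then show ?case using comm[of g h] by simp
next
  case (T_antisym a b c M)
  show ?case by (simp add: index_symmetricD(1)[OF sym, of a b c M])
next
  case (T_cyclic a b c M)
  show ?case by (simp add: index_symmetricD(2)[OF sym])
next
  case (S_sym a b M)
  show ?case by (simp add: index_symmetricD(3)[OF sym, of a b M])
next
  case (A_antisym a b M)
  show ?case by (simp add: index_symmetricD(4)[OF sym, of a b M])
next
  case (Anti3_antisym a b c M)
  show ?case by (simp add: index_symmetricD(5)[OF sym, of a b c M])
next
  case (Anti3_cyclic a b c M)
  show ?case by (simp add: index_symmetricD(6)[OF sym])
qed (simp_all add: algebra_simps)

lemma leibniz_ext_cong:
  assumes "x \<approx> y"
    and symu: "index_symmetric u" and symw: "index_symmetric w" and symv: "index_symmetric v"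
    and commu: "\<And>g h. u g * u h = koszul_sign g h *\<^sub>R (u h * u g)"
    and commw: "\<And>g h. w g * w h = koszul_sign g h *\<^sub>R (w h * w g)"
    and commv: "\<And>g h. v g * u h + w g * v h = koszul_sign g h *\<^sub>R (v h * u g + w h * v g)"
  shows "leibniz_ext u w v x = leibniz_ext u w v y"
  using assms(1)
proof (induction rule: expr_eq.induct)
  case (graded_comm g h)
  then show ?case using commv[of g h] by simp
next
  case (Times_cong x x' y y')
  then show ?case
    using hom_ext_cong[OF _ symu commu] hom_ext_cong[OF _ symw commw] by simp
next
  case (T_antisym a b c M)
  show ?case by (simp add: index_symmetricD(1)[OF symv, of a b c M])
next
  case (T_cyclic a b c M)
  show ?case by (simp add: index_symmetricD(2)[OF symv])
next
  case (S_sym a b M)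
  show ?case by (simp add: index_symmetricD(3)[OF symv, of a b M])
next
  case (A_antisym a b M)
  show ?case by (simp add: index_symmetricD(4)[OF symv, of a b M])
next
  case (Anti3_antisym a b c M)
  show ?case by (simp add: index_symmetricD(5)[OF symv, of a b c M])
next
  case (Anti3_cyclic a b c M)
  show ?case by (simp add: index_symmetricD(6)[OF symv])
qed (simp_all add: algebra_simps)


subsection \<open>Algebra structure\<close>

instantiation jet_algebra :: (type) real_algebra_1
begin

lift_definition zero_jet_algebra :: "'a jet_algebra" is "Scale 0 Unit" .
lift_definition one_jet_algebra :: "'a jet_algebra" is Unit .
lift_definition scaleR_jet_algebra :: "real \<Rightarrow> 'a jet_algebra \<Rightarrow> 'a jet_algebra" is Scale
  by (rule expr_eq.Scale_cong)
lift_definition plus_jet_algebra :: "'a jet_algebra \<Rightarrow> 'a jet_algebra \<Rightarrow> 'a jet_algebra" is Plus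
  by (rule expr_eq.Plus_cong)
lift_definition times_jet_algebra :: "'a jet_algebra \<Rightarrow> 'a jet_algebra \<Rightarrow> 'a jet_algebra" is Times
  by (rule expr_eq.Times_cong)
lift_definition uminus_jet_algebra :: "'a jet_algebra \<Rightarrow> 'a jet_algebra" is "Scale (-1)"
  by (rule expr_eq.Scale_cong)
lift_definition minus_jet_algebra :: "'a jet_algebra \<Rightarrow> 'a jet_algebra \<Rightarrow> 'a jet_algebra"
  is "\<lambda>x y. Plus x (Scale (-1) y)"
  by (intro expr_eq.Plus_cong expr_eq.Scale_cong)

instance
proof
  fix x y z :: "'a jet_algebra" and r s :: real
  show "x + y + z = x + (y + z)" by transfer (rule expr_eq.Plus_assoc)
  show "x + y = y + x" by transfer (rule expr_eq.Plus_comm)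
  show "0 + x = x" by transfer (rule expr_eq.Plus_zero)
  show "- x + x = 0" by transfer (rule expr_eq.Plus_minus)
  show "x - y = x + - y" by transfer (rule expr_eq.refl)
  show "r *\<^sub>R (x + y) = r *\<^sub>R x + r *\<^sub>R y" by transfer (rule expr_eq.Scale_Plus)
  show "(r + s) *\<^sub>R x = r *\<^sub>R x + s *\<^sub>R x" by transfer (rule expr_eq.Plus_Scale)
  show "r *\<^sub>R s *\<^sub>R x = (r * s) *\<^sub>R x" by transfer (rule expr_eq.Scale_Scale)
  show "1 *\<^sub>R x = x" by transfer (rule expr_eq.Scale_one)
  show "x * y * z = x * (y * z)" by transfer (rule expr_eq.Times_assoc)
  show "1 * x = x" by transfer (rule expr_eq.Times_Unit_left)
  show "x * 1 = x" by transfer (rule expr_eq.Times_Unit_right)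
  show "(x + y) * z = x * z + y * z" by transfer (rule expr_eq.Times_Plus_left)
  show "x * (y + z) = x * y + x * z" by transfer (rule expr_eq.Times_Plus_right)
  show "r *\<^sub>R x * y = r *\<^sub>R (x * y)" by transfer (rule expr_eq.Times_Scale_left)
  show "x * r *\<^sub>R y = r *\<^sub>R (x * y)" by transfer (rule expr_eq.Times_Scale_right)
  show "(0::'a jet_algebra) \<noteq> 1"
  proof (transfer, rule notI)
    assume "Scale 0 Unit \<approx> (Unit :: 'a expr)"
    then have "hom_ext (\<lambda>_. 0::real) (Scale 0 Unit :: 'a expr) = hom_ext (\<lambda>_. 0) (Unit :: 'a expr)"
      by (rule hom_ext_cong) (simp_all add: index_symmetric_def)
    then show False by simp
  qed
qed

end

lift_definition var :: "'n jet \<Rightarrow> 'n jet_algebra" is Var .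

lemma jet_algebra_induct [case_names var one scaleR add mult]:
  assumes "\<And>g. P (var g)" and "P 1" and "\<And>r x. P x \<Longrightarrow> P (r *\<^sub>R x)"
    and "\<And>x y. P x \<Longrightarrow> P y \<Longrightarrow> P (x + y)" and "\<And>x y. P x \<Longrightarrow> P y \<Longrightarrow> P (x * y)"
  shows "P x"
proof -
  have "P (abs_jet_algebra e)" for e
  proof (induction e)
    case (Var g) then show ?case using assms(1) by (metis var.abs_eq)
  next
    case Unit then show ?case using assms(2) by (metis one_jet_algebra.abs_eq)
  next
    case (Scale r e) then show ?case using assms(3) by (metis scaleR_jet_algebra.abs_eq)
  next
    case (Plus e f) then show ?case using assms(4) by (metis plus_jet_algebra.abs_eq)
  next
    case (Times e f) then show ?case using assms(5) by (metis times_jet_algebra.abs_eq)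
  qed
  then show ?thesis by (metis Quotient3_abs_rep Quotient3_jet_algebra)
qed

lemma var_T_antisym: "var (FieldT a b c, M) = - var (FieldT b a c, M)"
  by transfer (rule expr_eq.T_antisym)

lemma var_T_cyclic: "var (FieldT a b c, M) + var (FieldT c a b, M) + var (FieldT b c a, M) = 0"
  by transfer (rule expr_eq.T_cyclic)

lemma var_S_sym: "var (GhostS a b, M) = var (GhostS b a, M)"
  by transfer (rule expr_eq.S_sym)

lemma var_A_antisym: "var (GhostA a b, M) = - var (GhostA b a, M)"
  by transfer (rule expr_eq.A_antisym)

lemma var_Anti3_antisym: "var (Anti3 a b c, M) = - var (Anti3 b a c, M)"
  by transfer (rule expr_eq.Anti3_antisym)

lemma var_Anti3_cyclic: "var (Anti3 a b c, M) + var (Anti3 c a b, M) + var (Anti3 b c a, M) = 0"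
  by transfer (rule expr_eq.Anti3_cyclic)

lemmas var_symmetries = var_T_antisym var_T_cyclic var_S_sym var_A_antisym
  var_Anti3_antisym var_Anti3_cyclic

lemma index_symmetric_var: "index_symmetric var"
  unfolding index_symmetric_def by (intro allI conjI) (rule var_symmetries)+

lemma var_graded_comm: "var g * var h = koszul_sign g h *\<^sub>R (var h * var g)"
  by transfer (rule expr_eq.graded_comm)


section \<open>Derivations\<close>

definition var_partial :: "'n \<Rightarrow> 'n jet \<Rightarrow> 'n jet_algebra" where
  "var_partial a g = var (fst g, add_mset a (snd g))"

lift_definition partial :: "'n \<Rightarrow> 'n jet_algebra \<Rightarrow> 'n jet_algebra"
  is "\<lambda>a. leibniz_ext var var (var_partial a)"
proof -
  fix a :: 'n and x y :: "'n expr"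
  assume "x \<approx> y"
  then show "leibniz_ext var var (var_partial a) x = leibniz_ext var var (var_partial a) y"
  proof (rule leibniz_ext_cong)
    show "index_symmetric (var_partial a)"
      unfolding index_symmetric_def var_partial_def fst_conv snd_conv
      by (intro allI conjI) (rule var_symmetries)+
    fix g h :: "'n jet"
    have "koszul_sign (fst g, M) h = koszul_sign g h" "koszul_sign g (fst h, M) = koszul_sign g h"
      for M by (simp_all add: koszul_sign_def)
    then show "var_partial a g * var h + var g * var_partial a h =
        koszul_sign g h *\<^sub>R (var_partial a h * var g + var h * var_partial a g)"
      unfolding var_partial_def
      using var_graded_comm[of "(fst g, add_mset a (snd g))" h]
        var_graded_comm[of g "(fst h, add_mset a (snd h))"]
      by (simp add: scaleR_add_right add.commute)
  qed (fact index_symmetric_var var_graded_comm)+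
qed

lemma index_symmetric_parity: "index_symmetric (\<lambda>g :: 'n jet. parity_sign g *\<^sub>R var g)"
  unfolding index_symmetric_def
proof (intro allI conjI)
  fix a b c :: 'n and M
  let ?v = "\<lambda>g :: 'n jet. parity_sign g *\<^sub>R var g"
  note [simp] = parity_sign_def
  show "?v (FieldT a b c, M) = - ?v (FieldT b a c, M)"
    using var_T_antisym[of a b c M] by simp
  show "?v (FieldT a b c, M) + ?v (FieldT c a b, M) + ?v (FieldT b c a, M) = 0"
    using var_T_cyclic[of a b c M] by simp
  show "?v (GhostS a b, M) = ?v (GhostS b a, M)"
    using var_S_sym[of a b M] by simp
  show "?v (GhostA a b, M) = - ?v (GhostA b a, M)"
    using var_A_antisym[of a b M] by simp
  show "?v (Anti3 a b c, M) = - ?v (Anti3 b a c, M)"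
    using var_Anti3_antisym[of a b c M] by simp
  have "?v (Anti3 a b c, M) + ?v (Anti3 c a b, M) + ?v (Anti3 b c a, M)
      = - (var (Anti3 a b c, M) + var (Anti3 c a b, M) + var (Anti3 b c a, M))"
    by simp
  also have "\<dots> = 0" by (simp only: var_Anti3_cyclic neg_equal_0_iff_equal)
  finally show "?v (Anti3 a b c, M) + ?v (Anti3 c a b, M) + ?v (Anti3 b c a, M) = 0" .
qed

text \<open>The algebra automorphism \<open>x \<mapsto> (-1)^{|x|} x\<close>, with \<open>|x|\<close> the Grassmann parity.\<close>

lift_definition parity_inv :: "'n jet_algebra \<Rightarrow> 'n jet_algebra"
  is "hom_ext (\<lambda>g. parity_sign g *\<^sub>R var g)"
proof -
  fix x y :: "'n expr"
  assume "x \<approx> y"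
  then show "hom_ext (\<lambda>g. parity_sign g *\<^sub>R var g) x = hom_ext (\<lambda>g. parity_sign g *\<^sub>R var g) y"
  proof (rule hom_ext_cong)
    show "index_symmetric (\<lambda>g :: 'n jet. parity_sign g *\<^sub>R var g)"
      by (rule index_symmetric_parity)
    fix g h :: "'n jet"
    show "parity_sign g *\<^sub>R var g * parity_sign h *\<^sub>R var h =
        koszul_sign g h *\<^sub>R (parity_sign h *\<^sub>R var h * parity_sign g *\<^sub>R var g)"
      using var_graded_comm[of g h] by (simp add: mult.commute)
  qed
qed

fun gamma_var :: "'n jet \<Rightarrow> 'n jet_algebra" where
  "gamma_var (FieldT a b c, M) =
     var (GhostS b c, add_mset a M) - var (GhostS a c, add_mset b M)
     + var (GhostA b c, add_mset a M) - var (GhostA a c, add_mset b M)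
     - 2 *\<^sub>R var (GhostA a b, add_mset c M)"
| "gamma_var (GhostS a b, M) =
     3 *\<^sub>R (var (GhostC b, add_mset a M) + var (GhostC a, add_mset b M))"
| "gamma_var (GhostA a b, M) = var (GhostC b, add_mset a M) - var (GhostC a, add_mset b M)"
| "gamma_var _ = 0"

lemma var_comm_odd: "odd_field (fst g) \<Longrightarrow> odd_field (fst h) \<Longrightarrow> var g * var h = - (var h * var g)"
  using var_graded_comm[of g h] by (simp add: koszul_sign_def)

lemma var_comm_even: "\<not> odd_field (fst g) \<or> \<not> odd_field (fst h) \<Longrightarrow> var g * var h = var h * var g"
  using var_graded_comm[of g h] by (auto simp: koszul_sign_def)

lemma gamma_var_comm_even: "\<not> odd_field (fst h) \<Longrightarrow> gamma_var g * var h = var h * gamma_var g"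
  using var_comm_even[of _ h]
  by (cases g rule: gamma_var.cases) (simp_all add: algebra_simps)

lemma gamma_var_comm_odd:
  "odd_field (fst h) \<Longrightarrow> gamma_var g * var h = - parity_sign g *\<^sub>R (var h * gamma_var g)"
  using var_comm_even[of _ h] var_comm_odd[of _ h]
  by (cases g rule: gamma_var.cases) (simp_all add: algebra_simps parity_sign_def)

text \<open>
  An odd derivation satisfies \<open>\<gamma>(x y) = \<gamma> x y + (-1)^{|x|} x \<gamma> y\<close>, i.e. it acts from the left.
\<close>

lift_definition gamma :: "'n jet_algebra \<Rightarrow> 'n jet_algebra"
  is "leibniz_ext var (\<lambda>g. parity_sign g *\<^sub>R var g) gamma_var"
proof -
  fix x y :: "'n expr"
  assume "x \<approx> y"
  then show "leibniz_ext var (\<lambda>g. parity_sign g *\<^sub>R var g) gamma_var x =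
    leibniz_ext var (\<lambda>g. parity_sign g *\<^sub>R var g) gamma_var y"
  proof (rule leibniz_ext_cong)
    show "index_symmetric (\<lambda>g :: 'n jet. parity_sign g *\<^sub>R var g)"
      by (rule index_symmetric_parity)
    show "index_symmetric (gamma_var :: 'n jet \<Rightarrow> _)"
      unfolding index_symmetric_def
    proof (intro allI conjI)
      fix a b c :: 'n and M
      show "gamma_var (FieldT a b c, M) = - gamma_var (FieldT b a c, M)"
        using var_A_antisym[of b a] by (simp add: algebra_simps)
      show "gamma_var (FieldT a b c, M) + gamma_var (FieldT c a b, M) + gamma_var (FieldT b c a, M) = 0"
        using var_A_antisym[of b a] var_A_antisym[of c b] var_A_antisym[of c a]
          var_S_sym[of b a] var_S_sym[of c b] var_S_sym[of c a]
        by (simp add: algebra_simps scaleR_2)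
    qed (simp_all add: algebra_simps)
    fix g h :: "'n jet"
    show "parity_sign g *\<^sub>R var g * parity_sign h *\<^sub>R var h =
        koszul_sign g h *\<^sub>R (parity_sign h *\<^sub>R var h * parity_sign g *\<^sub>R var g)"
      using var_graded_comm[of g h] by (simp add: mult.commute)
    show "gamma_var g * var h + parity_sign g *\<^sub>R var g * gamma_var h =
        koszul_sign g h *\<^sub>R (gamma_var h * var g + parity_sign h *\<^sub>R var h * gamma_var g)"
      using gamma_var_comm_even[of g h] gamma_var_comm_even[of h g]
        gamma_var_comm_odd[of g h] gamma_var_comm_odd[of h g]
      by (cases "odd_field (fst g)"; cases "odd_field (fst h)")
         (simp_all add: koszul_sign_def parity_sign_def)
  qed (fact index_symmetric_var var_graded_comm)+
qed


subsection \<open>Characterization of the derivations\<close>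

lemma hom_ext_var: "hom_ext var x = abs_jet_algebra x"
  by (induction x)
    (simp_all add: var.abs_eq one_jet_algebra.abs_eq scaleR_jet_algebra.abs_eq
      plus_jet_algebra.abs_eq times_jet_algebra.abs_eq)

lemma partial_var: "partial a (var (f, M)) = var (f, add_mset a M)"
  by transfer (simp add: var_partial_def)

lemma partial_one [simp]: "partial a 1 = 0"
  by transfer simp

lemma partial_add [simp]: "partial a (x + y) = partial a x + partial a y"
  by transfer simp

lemma partial_scaleR [simp]: "partial a (r *\<^sub>R x) = r *\<^sub>R partial a x"
  by transfer simp

lemma partial_minus [simp]: "partial a (- x) = - partial a x"
  using partial_scaleR[of a "-1" x] by simp

lemma partial_diff [simp]: "partial a (x - y) = partial a x - partial a y"
  using partial_add[of a x "- y"] by simp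

lemma partial_zero [simp]: "partial a 0 = 0"
  using partial_scaleR[of a 0 0] by simp

lemma partial_mult: "partial a (x * y) = partial a x * y + x * partial a y"
proof -
  obtain e f where "x = abs_jet_algebra e" "y = abs_jet_algebra f"
    by (metis Quotient3_abs_rep Quotient3_jet_algebra)
  then show ?thesis
    by (simp add: times_jet_algebra.abs_eq partial.abs_eq hom_ext_var)
qed

lemma partial_commute: "partial a (partial b x) = partial b (partial a x)"
proof (induction x rule: jet_algebra_induct)
  case (var g)
  then show ?case by (cases g) (simp add: partial_var add_mset_commute)
next
  case (mult x y)
  then show ?case by (simp add: partial_mult)
qed simp_all

lemma parity_inv_var: "parity_inv (var g) = parity_sign g *\<^sub>R var g"
  by transfer simp

lemma parity_inv_one [simp]: "parity_inv 1 = 1"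
  by transfer simp

lemma parity_inv_add [simp]: "parity_inv (x + y) = parity_inv x + parity_inv y"
  by transfer simp

lemma parity_inv_scaleR [simp]: "parity_inv (r *\<^sub>R x) = r *\<^sub>R parity_inv x"
  by transfer simp

lemma parity_inv_mult [simp]: "parity_inv (x * y) = parity_inv x * parity_inv y"
  by transfer simp

lemma parity_inv_minus [simp]: "parity_inv (- x) = - parity_inv x"
  using parity_inv_scaleR[of "-1" x] by simp

lemma parity_inv_diff [simp]: "parity_inv (x - y) = parity_inv x - parity_inv y"
  using parity_inv_add[of x "- y"] by simp

lemma parity_inv_zero [simp]: "parity_inv 0 = 0"
  using parity_inv_scaleR[of 0 0] by simp

lemma parity_inv_parity_inv [simp]: "parity_inv (parity_inv x) = x"
  by (induction x rule: jet_algebra_induct) (simp_all add: parity_inv_var parity_sign_def)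

lemma parity_inv_partial: "parity_inv (partial a x) = partial a (parity_inv x)"
proof (induction x rule: jet_algebra_induct)
  case (var g)
  then show ?case by (cases g) (simp add: partial_var parity_inv_var parity_sign_def)
qed (simp_all add: partial_mult)

lemma gamma_gamma_var: "gamma (var g) = gamma_var g"
  by transfer simp

lemma gamma_one [simp]: "gamma 1 = 0"
  by transfer simp

lemma gamma_add [simp]: "gamma (x + y) = gamma x + gamma y"
  by transfer simp

lemma gamma_scaleR [simp]: "gamma (r *\<^sub>R x) = r *\<^sub>R gamma x"
  by transfer simp

lemma gamma_zero [simp]: "gamma 0 = 0"
  using gamma_scaleR[of 0 0] by simp

lemma gamma_minus [simp]: "gamma (- x) = - gamma x"
  using gamma_scaleR[of "-1" x] by simp

lemma gamma_diff [simp]: "gamma (x - y) = gamma x - gamma y"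
  using gamma_add[of x "- y"] by simp

lemma gamma_mult: "gamma (x * y) = gamma x * y + parity_inv x * gamma y"
proof -
  obtain e f where "x = abs_jet_algebra e" "y = abs_jet_algebra f"
    by (metis Quotient3_abs_rep Quotient3_jet_algebra)
  then show ?thesis
    by (simp add: times_jet_algebra.abs_eq gamma.abs_eq parity_inv.abs_eq hom_ext_var)
qed

lemma gamma_partial: "gamma (partial d x) = partial d (gamma x)"
proof (induction x rule: jet_algebra_induct)
  case (var g)
  then show ?case
    by (cases g rule: gamma_var.cases)
      (simp_all add: partial_var gamma_gamma_var add_mset_commute)
next
  case (mult x y)
  then show ?case by (simp add: partial_mult gamma_mult parity_inv_partial algebra_simps)
qed simp_all

lemma gamma_fields:
  "gamma (var (FieldT a b c, {#})) =
     partial a (var (GhostS b c, {#})) - partial b (var (GhostS a c, {#}))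
     + partial a (var (GhostA b c, {#})) - partial b (var (GhostA a c, {#}))
     - 2 *\<^sub>R partial c (var (GhostA a b, {#}))"
  "gamma (var (GhostS a b, {#})) =
     3 *\<^sub>R (partial a (var (GhostC b, {#})) + partial b (var (GhostC a, {#})))"
  "gamma (var (GhostA a b, {#})) = partial a (var (GhostC b, {#})) - partial b (var (GhostC a, {#}))"
  "gamma (var (GhostC a, {#})) = 0"
  "is_antifield f \<Longrightarrow> gamma (var (f, {#})) = 0"
  by (cases f; simp add: gamma_gamma_var partial_var)+

lemma gamma_unique:
  assumes add: "\<And>x y. \<delta> (x + y) = \<delta> x + \<delta> y"
    and scale: "\<And>r x. \<delta> (r *\<^sub>R x) = r *\<^sub>R \<delta> x"
    and mult: "\<And>x y. \<delta> (x * y) = \<delta> x * y + parity_inv x * \<delta> y"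
    and part: "\<And>a x. \<delta> (partial a x) = partial a (\<delta> x)"
    and fields: "\<And>f. \<delta> (var (f, {#})) = gamma (var (f, {#}))"
  shows "\<delta> = gamma"
proof
  fix x
  show "\<delta> x = gamma x"
  proof (induction x rule: jet_algebra_induct)
    case (var g)
    obtain f M where "g = (f, M)" by (cases g)
    moreover have "\<delta> (var (f, M)) = gamma (var (f, M))"
      by (induction M) (simp_all add: fields part gamma_partial flip: partial_var)
    ultimately show ?case by simp
  next
    case one
    show ?case using mult[of 1 1] by simp
  qed (simp_all add: add scale mult gamma_mult)
qed

lemma parity_inv_gamma: "parity_inv (gamma x) = - gamma (parity_inv x)"
proof (induction x rule: jet_algebra_induct)
  case (var g)
  then show ?case
    by (cases g rule: gamma_var.cases)
      (simp_all add: gamma_gamma_var parity_inv_var parity_sign_def algebra_simps)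
next
  case (mult x y)
  then show ?case by (simp add: gamma_mult)
qed simp_all

lemma gamma_gamma [simp]: "gamma (gamma x) = 0"
proof (induction x rule: jet_algebra_induct)
  case (var g)
  have "3 *\<^sub>R y = y + y + y" for y :: "'a jet_algebra"
    using scaleR_add_left[of 2 1 y] by (simp add: scaleR_2)
  then show ?case
    by (cases g rule: gamma_var.cases)
      (simp_all add: gamma_gamma_var add_mset_commute algebra_simps scaleR_2)
next
  case (mult x y)
  then show ?case by (simp add: gamma_mult parity_inv_gamma)
qed simp_all


section \<open>Cohomology\<close>

definition subset_ring :: "'a::ring_1 set \<Rightarrow> 'a ring" where
  "subset_ring B = \<lparr>carrier = B, mult = (*), one = 1, zero = 0, add = (+)\<rparr>"

definition cocycle_ring :: "('a::ring_1 \<Rightarrow> 'a) \<Rightarrow> 'a ring" where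
  "cocycle_ring \<delta> = subset_ring {x. \<delta> x = 0}"

definition cohomology_ring :: "('a::ring_1 \<Rightarrow> 'a) \<Rightarrow> 'a set ring" where
  "cohomology_ring \<delta> = cocycle_ring \<delta> Quot range \<delta>"

definition cohomology_class :: "('a::ring_1 \<Rightarrow> 'a) \<Rightarrow> 'a \<Rightarrow> 'a set" where
  "cohomology_class \<delta> x = range \<delta> +>\<^bsub>cocycle_ring \<delta>\<^esub> x"

lemma ring_cocycle_ring_gamma: "ring (cocycle_ring (gamma :: 'n jet_algebra \<Rightarrow> _))"
proof (intro ringI abelian_groupI monoidI)
  fix x :: "'n jet_algebra"
  assume "x \<in> carrier (cocycle_ring gamma)"
  then show "\<exists>y\<in>carrier (cocycle_ring gamma).
      y \<oplus>\<^bsub>cocycle_ring gamma\<^esub> x = \<zero>\<^bsub>cocycle_ring gamma\<^esub>"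
    by (intro bexI[of _ "- x"]) (simp_all add: cocycle_ring_def subset_ring_def)
qed (simp_all add: cocycle_ring_def subset_ring_def gamma_mult algebra_simps)

lemma ideal_range_gamma: "ideal (range gamma) (cocycle_ring (gamma :: 'n jet_algebra \<Rightarrow> _))"
proof (rule idealI)
  show "ring (cocycle_ring (gamma :: 'n jet_algebra \<Rightarrow> _))"
    by (rule ring_cocycle_ring_gamma)
  show "subgroup (range gamma) (add_monoid (cocycle_ring (gamma :: 'n jet_algebra \<Rightarrow> _)))"
  proof
    show "range gamma \<subseteq> carrier (add_monoid (cocycle_ring (gamma :: 'n jet_algebra \<Rightarrow> _)))"
      by (auto simp: cocycle_ring_def subset_ring_def)
    fix x y :: "'n jet_algebra"
    assume x: "x \<in> range gamma" and "y \<in> range gamma"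
    then obtain x' y' where x': "x = gamma x'" and "y = gamma y'" by blast
    then have "x + y = gamma (x' + y')" by simp
    then show "x \<otimes>\<^bsub>add_monoid (cocycle_ring gamma)\<^esub> y \<in> range gamma"
      by (simp add: cocycle_ring_def subset_ring_def del: gamma_add)
    interpret ring "cocycle_ring (gamma :: 'n jet_algebra \<Rightarrow> _)"
      by (rule ring_cocycle_ring_gamma)
    have "\<ominus>\<^bsub>cocycle_ring gamma\<^esub> x = gamma (- x')"
      by (rule minus_equality) (simp_all add: x' cocycle_ring_def subset_ring_def)
    then show "inv\<^bsub>add_monoid (cocycle_ring gamma)\<^esub> x \<in> range gamma"
      by (simp add: a_inv_def del: gamma_minus)
  next
    show "\<one>\<^bsub>add_monoid (cocycle_ring gamma)\<^esub> \<in> range (gamma :: 'n jet_algebra \<Rightarrow> _)"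
      by (auto simp: cocycle_ring_def subset_ring_def intro!: image_eqI[of _ _ 0])
  qed
next
  fix a x :: "'n jet_algebra"
  assume "a \<in> range gamma" and "x \<in> carrier (cocycle_ring gamma)"
  then obtain y where a: "a = gamma y" and x: "gamma x = 0"
    by (auto simp: cocycle_ring_def subset_ring_def)
  have "gamma (parity_inv x) = 0"
    using parity_inv_gamma[of x] x by simp
  then have "x * a = gamma (parity_inv x * y)"
    by (simp add: gamma_mult a)
  then show "x \<otimes>\<^bsub>cocycle_ring gamma\<^esub> a \<in> range gamma"
    by (simp add: cocycle_ring_def subset_ring_def)
  have "a * x = gamma (y * x)"
    by (simp add: gamma_mult a x)
  then show "a \<otimes>\<^bsub>cocycle_ring gamma\<^esub> x \<in> range gamma"
    by (simp add: cocycle_ring_def subset_ring_def)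
qed


section \<open>The variables generating the cohomology\<close>

definition F_A :: "'n \<Rightarrow> 'n \<Rightarrow> 'n \<Rightarrow> 'n jet_algebra" where
  "F_A a b c = (1 / 3) *\<^sub>R
     (partial c (var (GhostA a b, {#})) + partial a (var (GhostA b c, {#}))
      + partial b (var (GhostA c a, {#})))"

text \<open>
  A tensor is a function of the assignment \<open>i :: nat \<Rightarrow> 'n\<close> of an index value to every index
  position; (anti)symmetrization acts on a set \<open>P\<close> of positions.
\<close>

definition symmetrize ::
    "nat set \<Rightarrow> ((nat \<Rightarrow> 'n) \<Rightarrow> 'b::real_vector) \<Rightarrow> (nat \<Rightarrow> 'n) \<Rightarrow> 'b" where
  "symmetrize P t i = (1 / fact (card P)) *\<^sub>R (\<Sum>\<pi> | \<pi> permutes P. t (i \<circ> \<pi>))"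

definition antisymmetrize ::
    "nat set \<Rightarrow> ((nat \<Rightarrow> 'n) \<Rightarrow> 'b::real_vector) \<Rightarrow> (nat \<Rightarrow> 'n) \<Rightarrow> 'b" where
  "antisymmetrize P t i =
     (1 / fact (card P)) *\<^sub>R (\<Sum>\<pi> | \<pi> permutes P. of_int (sign \<pi>) *\<^sub>R t (i \<circ> \<pi>))"

text \<open>
  Positions in \<open>\<partial>_{d_1 ... d_k} T_{[ab]c}\<close>: \<open>a\<close>, \<open>b\<close>, \<open>c\<close> are \<open>0\<close>, \<open>1\<close>, \<open>2\<close>,
  and \<open>d_j\<close> is \<open>j + 2\<close>.
\<close>

definition T_jet :: "nat \<Rightarrow> (nat \<Rightarrow> 'n) \<Rightarrow> 'n jet_algebra" where
  "T_jet k i = var (FieldT (i 0) (i 1) (i 2), mset (map i [3..<k + 3]))"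

text \<open>
  The Young tableau has the rows \<open>a c d_1 ... d_{k-2}\<close>, \<open>b d_{k-1}\<close>, \<open>d_k\<close>; only used for \<open>k \<ge> 2\<close>.
\<close>

definition E_T :: "nat \<Rightarrow> (nat \<Rightarrow> 'n) \<Rightarrow> 'n jet_algebra" where
  "E_T k =
     antisymmetrize {2, k + 1} (antisymmetrize {0, 1, k + 2}
       (symmetrize {1, k + 1} (symmetrize ({0, 2} \<union> {3..k}) (T_jet k))))"

definition cohomology_variables :: "'n jet_algebra set" where
  "cohomology_variables =
     {var (GhostC a, {#}) | a. True}
     \<union> {F_A a b c | a b c. True}
     \<union> {E_T k i | k i. k \<ge> 2}
     \<union> {var (f, M) | f M. is_antifield f}"

definition is_subalgebra :: "'a::real_algebra_1 set \<Rightarrow> bool" where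
  "is_subalgebra B \<longleftrightarrow> subspace B \<and> 1 \<in> B \<and> (\<forall>x\<in>B. \<forall>y\<in>B. x * y \<in> B)"

definition cohomology_polynomials :: "'n jet_algebra set" where
  "cohomology_polynomials = is_subalgebra hull (span cohomology_variables)"

end

(*
  On the linear span of the jet variables there is an explicit homotopy s with
  gamma s + s gamma = 1 - p, where p projects onto the span of the claimed generators and s kills
  them. Extending s to an odd derivation, N = gamma s + s gamma becomes an even derivation that
  vanishes on the claimed subalgebra and multiplies a monomial by its number of contractible
  factors. So the algebra is the sum of that subalgebra and of the eigenspaces of N with positive
  eigenvalues, where gamma-closed elements are exact. No basis of the algebra is needed.

  For the linear part, put X = S/6 + A/2, so that gamma X_ab = d_a C_b. An order-n jet of X minus
  s gamma of it is a mean of the curls d_i X_ab - d_a X_ib, each equal to gamma T_iab / 6 + F_iab,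
  and the derivatives of F are gamma-exact by the Bianchi identity. On the jets of T, the defect
  of the homotopy is a combination of derivatives of the linearized curvature, which the Young
  projections E^T reproduce up to a nonzero factor.
*)
theory Submission
  imports Defs
begin

text \<open>Linear functionals separate points. Testing an identity of vectors against all of them
  turns it into real arithmetic, which \<open>linarith\<close> and \<open>field_simps\<close> can
  settle.\<close>

lemma linear_functional_eqI:
  fixes x y :: "'a::real_vector"
  assumes "\<And>\<phi> :: 'a \<Rightarrow> real. linear \<phi> \<Longrightarrow> \<phi> x = \<phi> y"
  shows "x = y"
proof (rule ccontr)
  assume "x \<noteq> y"
  then have "independent {x - y}" by (simp add: dependent_single)
  then obtain \<phi> :: "'a \<Rightarrow> real" where "linear \<phi>" "\<phi> (x - y) = 1"
    using linear_independent_extend[of "{x - y}" "\<lambda>_. 1 :: real"] by auto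
  then show False using assms[of \<phi>] by (simp add: linear_diff)
qed

lemma linear_sum_mset:
  assumes "linear f"
  shows "f (\<Sum>i\<in>#M. g i) = (\<Sum>i\<in>#M. f (g i))"
  by (induction M) (simp_all add: linear_0[OF assms] linear_add[OF assms])

section \<open>Odd derivations\<close>

locale odd_derivation =
  fixes \<delta> :: "'n jet_algebra \<Rightarrow> 'n jet_algebra"
  assumes add: "\<delta> (x + y) = \<delta> x + \<delta> y"
    and scaleR: "\<delta> (r *\<^sub>R x) = r *\<^sub>R \<delta> x"
    and mult: "\<delta> (x * y) = \<delta> x * y + parity_inv x * \<delta> y"
    and parity: "parity_inv (\<delta> x) = - \<delta> (parity_inv x)"
begin

lemma linear: "linear \<delta>"
  by (rule linearI) (simp_all add: add scaleR)

end

text \<open>The elements of Grassmann parity \<open>b\<close> (\<open>True\<close> is odd) that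
  commute with every generator up to the Koszul sign. These are the values that a derivation may
  take on generators.\<close>

definition graded_central :: "bool \<Rightarrow> 'n jet_algebra set" where
  "graded_central b = {x. parity_inv x = (if b then - x else x) \<and>
     (\<forall>h. x * var h = (if b then parity_sign h else 1) *\<^sub>R (var h * x))}"

lemma subspace_graded_central: "subspace (graded_central b)"
  unfolding subspace_def graded_central_def by (auto simp: algebra_simps)

lemma var_graded_central: "b = odd_field f \<Longrightarrow> var (f, M) \<in> graded_central b"
  using var_comm_even[of "(f, M)"] var_comm_odd[of "(f, M)"]
  by (auto simp: graded_central_def parity_sign_def parity_inv_var)

text \<open>A Leibniz extension descends to the quotient as soon as it respects the relations among
  generators: the index symmetries and graded commutativity. The two hypotheses on \<open>v\<close>
  say just this.\<close>

lemma odd_derivation_exists: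
  fixes v :: "'n jet \<Rightarrow> 'n jet_algebra"
  assumes sym: "index_symmetric v" and deg: "\<And>g. v g \<in> graded_central (\<not> odd_field (fst g))"
  obtains \<delta> where "odd_derivation \<delta>" "\<And>g. \<delta> (var g) = v g"
proof -
  let ?w = "\<lambda>g :: 'n jet. parity_sign g *\<^sub>R var g"
  define L where "L = leibniz_ext var ?w v"
  \<comment> \<open>The parity of \<open>v g\<close> is opposite to that of \<open>g\<close>, so a
    sign can occur only for even \<open>g\<close>.\<close>
  have comm: "v g * var h = (if odd_field (fst g) then 1 else parity_sign h) *\<^sub>R (var h * v g)" for g h
    using deg[of g] by (cases h) (auto simp: graded_central_def)
  have L_cong: "L x = L y" if "x \<approx> y" for x y
    unfolding L_def using that
  proof (rule leibniz_ext_cong)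
    show "index_symmetric ?w" by (rule index_symmetric_parity)
    fix g h :: "'n jet"
    show "?w g * ?w h = koszul_sign g h *\<^sub>R (?w h * ?w g)"
      using var_graded_comm[of g h] by (simp add: mult.commute)
    show "v g * var h + ?w g * v h = koszul_sign g h *\<^sub>R (v h * var g + ?w h * v g)"
      using comm[of g h] comm[of h g]
      by (cases "odd_field (fst g)"; cases "odd_field (fst h)")
         (simp_all add: koszul_sign_def parity_sign_def)
  qed (fact index_symmetric_var var_graded_comm sym)+
  \<comment> \<open>By \<open>L_cong\<close>, the choice of the representative does not
    matter.\<close>
  define \<delta> where "\<delta> x = L (rep_jet_algebra x)" for x
  have \<delta>_abs: "\<delta> (abs_jet_algebra e) = L e" for e
    unfolding \<delta>_def
    by (rule L_cong) (metis Quotient3_jet_algebra Quotient3_rep_abs expr_eq.refl)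
  have \<delta>_var: "\<delta> (var g) = v g" for g
    by (simp add: var.abs_eq \<delta>_abs L_def)
  have one: "\<delta> 1 = 0"
    by (simp add: one_jet_algebra.abs_eq \<delta>_abs L_def)
  have abs_ex: "\<exists>e. x = abs_jet_algebra e" for x :: "'n jet_algebra"
    by (metis Quotient3_abs_rep Quotient3_jet_algebra)
  have add: "\<delta> (x + y) = \<delta> x + \<delta> y" for x y
    using abs_ex[of x] abs_ex[of y] by (auto simp: plus_jet_algebra.abs_eq \<delta>_abs L_def)
  have scale: "\<delta> (r *\<^sub>R x) = r *\<^sub>R \<delta> x" for r x
    using abs_ex[of x] by (auto simp: scaleR_jet_algebra.abs_eq \<delta>_abs L_def)
  have mult: "\<delta> (x * y) = \<delta> x * y + parity_inv x * \<delta> y" for x y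
    using abs_ex[of x] abs_ex[of y]
    by (auto simp: times_jet_algebra.abs_eq \<delta>_abs L_def hom_ext_var parity_inv.abs_eq)
  have parity: "parity_inv (\<delta> x) = - \<delta> (parity_inv x)" for x
  proof (induction x rule: jet_algebra_induct)
    case (var g)
    then show ?case using deg[of g]
      by (auto simp: \<delta>_var parity_inv_var scale parity_sign_def graded_central_def)
  qed (simp_all add: one add scale mult)
  have "odd_derivation \<delta>" by unfold_locales (fact add scale mult parity)+
  then show ?thesis using \<delta>_var by (rule that)
qed

lemma odd_derivation_gamma: "odd_derivation gamma"
  by unfold_locales (simp_all add: gamma_mult parity_inv_gamma)

section \<open>Cohomology from a contracting homotopy on the generators\<close>

lemma hull_subalgebra:
  "subspace (is_subalgebra hull B)" "1 \<in> is_subalgebra hull B"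
  "x \<in> is_subalgebra hull B \<Longrightarrow> y \<in> is_subalgebra hull B \<Longrightarrow> x * y \<in> is_subalgebra hull B"
proof -
  have "is_subalgebra (is_subalgebra hull B)"
  proof (rule hull_in)
    fix T :: "'a set set" assume "\<forall>s\<in>T. is_subalgebra s"
    then show "is_subalgebra (\<Inter>T)"
      unfolding is_subalgebra_def by (auto intro!: subspace_Inter)
  qed
  then show "subspace (is_subalgebra hull B)" "1 \<in> is_subalgebra hull B"
  "x \<in> is_subalgebra hull B \<Longrightarrow> y \<in> is_subalgebra hull B \<Longrightarrow> x * y \<in> is_subalgebra hull B"
    by (auto simp: is_subalgebra_def)
qed

text \<open>The homotopy identity is required on generators only; the derivation property carries
  its consequences to products.\<close>

locale homotopy = d: odd_derivation d + s: odd_derivation s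
  for d s :: "'n jet_algebra \<Rightarrow> 'n jet_algebra" +
  fixes H :: "'n jet_algebra set"
  assumes d_d: "d (d x) = 0"
    and d_H: "h \<in> H \<Longrightarrow> d h = 0"
    and s_H: "h \<in> H \<Longrightarrow> s h = 0"
    and projection: "var g - (d (s (var g)) + s (d (var g))) \<in> span H"
begin

section \<open>Eigenspaces of the anticommutator of \<open>d\<close> and \<open>s\<close>\<close>

definition N :: "'n jet_algebra \<Rightarrow> 'n jet_algebra" where
  "N x = d (s x) + s (d x)"

lemma linear_N: "linear N"
  by (rule linearI) (simp_all add: N_def d.add s.add d.scaleR s.scaleR algebra_simps)

text \<open>The anticommutator of two odd derivations is an even derivation: the mixed terms cancel
  because \<open>d\<close> and \<open>s\<close> both anticommute with
  \<open>parity_inv\<close>.\<close>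

lemma N_mult: "N (x * y) = N x * y + x * N y"
  by (simp add: N_def d.mult s.mult d.add s.add d.parity s.parity algebra_simps)

lemma d_N: "d (N x) = N (d x)"
  using linear_0[OF s.linear] by (simp add: N_def d.add d_d)

definition poly :: "'n jet_algebra set" where
  "poly = is_subalgebra hull (span H)"

text \<open>The kernel of \<open>f\<close> is a subalgebra containing \<open>H\<close>, hence
  contains the hull.\<close>

lemma vanish_on_poly:
  assumes "linear f" and mult: "\<And>x y. f x = 0 \<Longrightarrow> f y = 0 \<Longrightarrow> f (x * y) = 0"
    and "f 1 = 0" and "\<And>h. h \<in> H \<Longrightarrow> f h = 0" and "x \<in> poly"
  shows "f x = 0"
proof -
  have sub: "subspace {x. f x = 0}"
    by (rule linear_subspace_kernel[OF assms(1)])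
  have "is_subalgebra {x. f x = 0}"
    unfolding is_subalgebra_def using sub assms by auto
  moreover have "span H \<subseteq> {x. f x = 0}"
    by (rule span_minimal[OF _ sub]) (use assms in auto)
  ultimately have "poly \<subseteq> {x. f x = 0}"
    unfolding poly_def by (rule hull_minimal[rotated])
  then show ?thesis using assms by auto
qed

lemma d_one: "d 1 = 0"
  using d.mult[of 1 1] by simp

lemma s_one: "s 1 = 0"
  using s.mult[of 1 1] by simp

lemma d_poly: "x \<in> poly \<Longrightarrow> d x = 0"
  by (rule vanish_on_poly[OF d.linear]) (auto simp: d.mult d_one d_H)

lemma s_poly: "x \<in> poly \<Longrightarrow> s x = 0"
  by (rule vanish_on_poly[OF s.linear]) (auto simp: s.mult s_one s_H)

lemma N_poly: "x \<in> poly \<Longrightarrow> N x = 0"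
  by (simp add: N_def d_poly s_poly linear_0 d.linear s.linear)

definition eigenspace :: "nat \<Rightarrow> 'n jet_algebra set" where
  "eigenspace n = {x. N x = real n *\<^sub>R x}"

definition contractible :: "'n jet_algebra set" where
  "contractible = {\<Sum>n\<in>I. y n | I y. finite I \<and> 0 \<notin> I \<and> (\<forall>n\<in>I. y n \<in> eigenspace n)}"

lemma subspace_eigenspace: "subspace (eigenspace n)"
  unfolding subspace_def eigenspace_def
  by (auto simp: linear_0[OF linear_N] linear_add[OF linear_N] linear_scale[OF linear_N]
      algebra_simps)

lemma eigenspace_mult:
  "x \<in> eigenspace m \<Longrightarrow> y \<in> eigenspace n \<Longrightarrow> x * y \<in> eigenspace (m + n)"
  by (simp add: eigenspace_def N_mult algebra_simps)

lemma poly_subset_eigenspace: "x \<in> poly \<Longrightarrow> x \<in> eigenspace 0"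
  by (simp add: eigenspace_def N_poly)

lemma subspace_contractible: "subspace contractible"
  unfolding subspace_def
proof (intro conjI ballI allI)
  show "0 \<in> contractible"
    unfolding contractible_def by (intro CollectI exI[of _ "{}"]) simp
next
  fix x y assume "x \<in> contractible" "y \<in> contractible"
  then obtain I f J g where I: "finite I" "0 \<notin> I" "\<forall>n\<in>I. f n \<in> eigenspace n" "x = sum f I"
    and J: "finite J" "0 \<notin> J" "\<forall>n\<in>J. g n \<in> eigenspace n" "y = sum g J"
    unfolding contractible_def by blast
  let ?f = "\<lambda>n. (if n \<in> I then f n else 0) + (if n \<in> J then g n else 0)"
  have "x + y = sum ?f (I \<union> J)"
    using I J by (simp add: sum.distrib sum.If_cases Int_absorb1)
  moreover have "\<forall>n\<in>I \<union> J. ?f n \<in> eigenspace n"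
    using I J subspace_add[OF subspace_eigenspace] by auto
  ultimately show "x + y \<in> contractible"
    unfolding contractible_def using I J by blast
next
  fix x r assume "x \<in> contractible"
  then obtain I f where I: "finite I" "0 \<notin> I" "\<forall>n\<in>I. f n \<in> eigenspace n" "x = sum f I"
    unfolding contractible_def by blast
  then have "r *\<^sub>R x = (\<Sum>n\<in>I. r *\<^sub>R f n)" "\<forall>n\<in>I. r *\<^sub>R f n \<in> eigenspace n"
    using subspace_scale[OF subspace_eigenspace] by (auto simp: scaleR_sum_right)
  then show "r *\<^sub>R x \<in> contractible"
    unfolding contractible_def using I(1,2) by blast
qed

lemma eigenspace_contractible: "0 < n \<Longrightarrow> x \<in> eigenspace n \<Longrightarrow> x \<in> contractible"
  unfolding contractible_def by (intro CollectI exI[of _ "{n}"] exI[of _ "\<lambda>_. x"]) simp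

text \<open>Eigenvalues add under multiplication, so a positive one stays positive. The case
  \<open>m = 0\<close> covers factors from \<open>poly\<close>.\<close>

lemma contractible_mult_eigenspace:
  assumes "x \<in> contractible" "z \<in> eigenspace m"
  shows "x * z \<in> contractible" "z * x \<in> contractible"
proof -
  obtain I f where I: "finite I" "0 \<notin> I" "\<forall>n\<in>I. f n \<in> eigenspace n" "x = sum f I"
    using assms unfolding contractible_def by blast
  have "f n * z \<in> contractible \<and> z * f n \<in> contractible" if "n \<in> I" for n
  proof -
    have "0 < n" "f n \<in> eigenspace n" using that I by (auto intro: gr0I)
    then show ?thesis
      using eigenspace_mult[of "f n" n z m] eigenspace_mult[of z m "f n" n] assms(2)
      by (auto intro: eigenspace_contractible[of "n + m"] eigenspace_contractible[of "m + n"])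
  qed
  then show "x * z \<in> contractible" "z * x \<in> contractible"
    unfolding I sum_distrib_left sum_distrib_right
    by (auto intro!: subspace_sum[OF subspace_contractible])
qed

lemma contractible_mult:
  assumes "x \<in> contractible" "z \<in> contractible"
  shows "x * z \<in> contractible"
proof -
  obtain I f where I: "finite I" "0 \<notin> I" "\<forall>n\<in>I. f n \<in> eigenspace n" "x = sum f I"
    using assms unfolding contractible_def by blast
  then show ?thesis
    unfolding I sum_distrib_right using assms contractible_mult_eigenspace(2)
    by (auto intro!: subspace_sum[OF subspace_contractible])
qed

lemma decomposition: "\<exists>p\<in>poly. \<exists>y\<in>contractible. x = p + y"
proof (induction x rule: jet_algebra_induct)
  case (var g)
  \<comment> \<open>By \<open>projection\<close> this lies in the span of \<open>H\<close>, so
    \<open>N\<close> kills it; hence \<open>N (var g)\<close> is an eigenvector with eigenvalue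
    1.\<close>
  let ?p = "var g - N (var g)"
  have p: "?p \<in> poly"
    using projection[of g] hull_subset[of "span H" is_subalgebra] unfolding N_def poly_def by blast
  then have "N (var g) \<in> eigenspace 1"
    using N_poly[OF p] by (simp add: eigenspace_def linear_diff[OF linear_N])
  then have "N (var g) \<in> contractible" by (rule eigenspace_contractible[rotated]) simp
  with p show ?case by (intro bexI[of _ ?p] bexI[of _ "N (var g)"]) auto
next
  case one
  then show ?case
    using hull_subalgebra(2) subspace_0[OF subspace_contractible] unfolding poly_def
    by (intro bexI[of _ 1] bexI[of _ 0]) auto
next
  case (scaleR r x)
  then obtain p y where *: "p \<in> poly" "y \<in> contractible" "x = p + y" by blast
  then have "r *\<^sub>R x = r *\<^sub>R p + r *\<^sub>R y" by (simp add: scaleR_right_distrib)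
  moreover have "r *\<^sub>R p \<in> poly" "r *\<^sub>R y \<in> contractible"
    using * subspace_scale[OF subspace_contractible] subspace_scale[OF hull_subalgebra(1)]
    unfolding poly_def by auto
  ultimately show ?case by blast
next
  case (add x y)
  then obtain p y1 q y2 where *: "p \<in> poly" "y1 \<in> contractible" "x = p + y1"
     "q \<in> poly" "y2 \<in> contractible" "y = q + y2" by blast
  then have "x + y = (p + q) + (y1 + y2)" by simp
  moreover have "p + q \<in> poly" "y1 + y2 \<in> contractible"
    using * subspace_add[OF subspace_contractible] subspace_add[OF hull_subalgebra(1)]
    unfolding poly_def by auto
  ultimately show ?case by blast
next
  case (mult x y)
  then obtain p y1 q y2 where *: "p \<in> poly" "y1 \<in> contractible" "x = p + y1"
     "q \<in> poly" "y2 \<in> contractible" "y = q + y2" by blast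
  then have "x * y = p * q + (p * y2 + y1 * q + y1 * y2)" by (simp add: algebra_simps)
  moreover have "p * q \<in> poly" using * hull_subalgebra(3) unfolding poly_def by blast
  moreover have "p * y2 + y1 * q + y1 * y2 \<in> contractible"
    using * contractible_mult contractible_mult_eigenspace poly_subset_eigenspace
    by (intro subspace_add[OF subspace_contractible]) blast+
  ultimately show ?case by blast
qed

text \<open>Applying \<open>m - N\<close> removes the eigenvalue \<open>m\<close>.\<close>

lemma contractible_induct [consumes 1, case_names zero step]:
  assumes "y \<in> contractible"
    and "P 0"
    and "\<And>m x. 0 < m \<Longrightarrow> P (real m *\<^sub>R x - N x) \<Longrightarrow> P x"
  shows "P y"
proof -
  have "P (sum f I)" if "finite I" "0 \<notin> I" "\<forall>n\<in>I. f n \<in> eigenspace n" for I f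
    using that
  proof (induction I arbitrary: f)
    case (insert m I)
    have "real m *\<^sub>R sum f (insert m I) - N (sum f (insert m I))
        = (\<Sum>n\<in>insert m I. real m *\<^sub>R f n - N (f n))"
      by (simp only: linear_sum[OF linear_N] scaleR_sum_right sum_subtractf)
    \<comment> \<open>The summand of index \<open>m\<close> gets coefficient 0; the others are
      merely rescaled and stay in their eigenspaces.\<close>
    also have "\<dots> = (\<Sum>n\<in>insert m I. (real m - real n) *\<^sub>R f n)"
      using insert.prems by (intro sum.cong) (auto simp: eigenspace_def algebra_simps)
    also have "\<dots> = (\<Sum>n\<in>I. (real m - real n) *\<^sub>R f n)"
      using insert.hyps by simp
    finally have eq: "real m *\<^sub>R sum f (insert m I) - N (sum f (insert m I)) = \<dots>" .
    have "P (\<Sum>n\<in>I. (real m - real n) *\<^sub>R f n)"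
      using insert.prems subspace_scale[OF subspace_eigenspace] by (intro insert.IH) auto
    moreover have "0 < m" using insert.prems by (auto intro: gr0I)
    ultimately show ?case using assms(3) unfolding eq[symmetric] by blast
  qed (simp add: assms(2))
  then show ?thesis using assms(1) unfolding contractible_def by blast
qed

text \<open>For closed \<open>x\<close>, \<open>N x = d (s x)\<close> is exact. By induction
  \<open>m x - N x\<close> is exact too, and then so is \<open>x\<close>, since \<open>m\<close> is
  invertible.\<close>

lemma contractible_exact:
  assumes "y \<in> contractible" "d y = 0"
  shows "y \<in> range d"
  using assms
proof (induction y rule: contractible_induct)
  case zero
  then show ?case by (metis linear_0[OF d.linear] rangeI)
next
  case (step m x)
  have "N x = d (s x)" "d (N x) = 0"
    using step.prems linear_0[OF s.linear] d_N[of x] linear_0[OF linear_N] by (simp_all add: N_def)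
  moreover from this obtain z where "real m *\<^sub>R x - N x = d z"
    using step by (auto simp: linear_diff[OF d.linear] d.scaleR)
  ultimately have "real m *\<^sub>R x = d (s x + z)"
    by (simp add: d.add algebra_simps)
  then have "x = d ((1 / real m) *\<^sub>R (s x + z))"
    using step.hyps by (simp add: d.scaleR flip: \<open>real m *\<^sub>R x = d (s x + z)\<close>)
  then show ?case by blast
qed

text \<open>Only positive eigenvalues occur in \<open>contractible\<close>, so \<open>N\<close> is
  injective there.\<close>

lemma contractible_N_zero:
  assumes "y \<in> contractible" "N y = 0"
  shows "y = 0"
  using assms
proof (induction y rule: contractible_induct)
  case (step m x)
  then show ?case by (simp add: linear_scale[OF linear_N])
qed simp

text \<open>Since \<open>d\<close> commutes with \<open>N\<close>, it preserves each
  eigenspace.\<close>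

lemma d_contractible:
  assumes "y \<in> contractible"
  shows "d y \<in> contractible"
proof -
  obtain I f where I: "finite I" "0 \<notin> I" "\<forall>n\<in>I. f n \<in> eigenspace n" "y = sum f I"
    using assms unfolding contractible_def by blast
  have "d (f n) \<in> contractible" if "n \<in> I" for n
  proof (rule eigenspace_contractible)
    show "0 < n" using that I by (cases n) auto
    show "d (f n) \<in> eigenspace n"
      using that I by (auto simp: eigenspace_def d.scaleR simp flip: d_N)
  qed
  then show ?thesis
    unfolding I by (auto simp: linear_sum[OF d.linear] intro!: subspace_sum[OF subspace_contractible])
qed

text \<open>This gives surjectivity onto the cohomology: the \<open>poly\<close> part of a closed
  element is closed, so the contractible part is closed and therefore exact.\<close>

lemma closed_decomposition:
  assumes "d x = 0"
  obtains p where "p \<in> poly" "x - p \<in> range d"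
proof -
  obtain p y where *: "p \<in> poly" "y \<in> contractible" "x = p + y"
    using decomposition by blast
  then have "y \<in> range d"
    using assms d_poly by (intro contractible_exact) (auto simp: d.add)
  with * have "x - p \<in> range d" by (metis add_diff_cancel_left')
  with * show ?thesis by (intro that)
qed

text \<open>This gives injectivity: an exact \<open>p\<close> is \<open>d\<close> of a contractible
  element, so it is contractible itself, while \<open>N p = 0\<close>.\<close>

lemma poly_exact_zero:
  assumes "p \<in> poly" "p \<in> range d"
  shows "p = 0"
proof -
  obtain x q y where *: "q \<in> poly" "y \<in> contractible" "p = d x" "x = q + y"
    using decomposition assms by blast
  then have "p \<in> contractible"
    using d_contractible by (simp add: d.add d_poly)
  then show ?thesis
    by (rule contractible_N_zero) (rule N_poly, rule assms)
qed

end

section \<open>Passage to the cohomology ring\<close>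

lemma cohomology_iso_if_homotopy:
  fixes s :: "'n jet_algebra \<Rightarrow> 'n jet_algebra"
  assumes "homotopy gamma s H"
  shows "cohomology_class gamma \<in>
    ring_iso (subset_ring (is_subalgebra hull (span H))) (cohomology_ring gamma)"
proof -
  interpret homotopy gamma s H by fact
  interpret I: ideal "range gamma" "cocycle_ring (gamma :: 'n jet_algebra \<Rightarrow> _)"
    by (rule ideal_range_gamma)
  have carrier: "carrier (cocycle_ring (gamma :: 'n jet_algebra \<Rightarrow> _)) = {x. gamma x = 0}"
    by (simp add: cocycle_ring_def subset_ring_def)
  have hom: "cohomology_class gamma \<in> ring_hom (cocycle_ring gamma) (cohomology_ring (gamma :: 'n jet_algebra \<Rightarrow> _))"
    using I.rcos_ring_hom
    by (simp add: cohomology_class_def [abs_def] cohomology_ring_def)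
  have coset: "cohomology_class gamma x = (\<lambda>h. h + x) ` range gamma" for x :: "'n jet_algebra"
    by (auto simp: cohomology_class_def a_r_coset_def' cocycle_ring_def subset_ring_def)
  have eq_iff: "cohomology_class gamma x = cohomology_class gamma y \<longleftrightarrow> x - y \<in> range gamma"
    for x y :: "'n jet_algebra"
  proof
    assume "cohomology_class gamma x = cohomology_class gamma y"
    moreover have "x \<in> cohomology_class gamma x"
      unfolding coset by (rule image_eqI[of _ _ 0]) (simp, metis gamma_zero rangeI)
    ultimately obtain h where "x = gamma h + y" unfolding coset by blast
    then show "x - y \<in> range gamma" by simp
  next
    assume "x - y \<in> range gamma"
    then obtain h where h: "x = gamma h + y" by (metis diff_add_cancel rangeE)
    have "gamma k + x = gamma (k + h) + y" "gamma k + y = gamma (k - h) + x" for k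
      by (simp_all add: h)
    then show "cohomology_class gamma x = cohomology_class gamma y"
      unfolding coset image_image by (intro subset_antisym image_subsetI) (blast intro: image_eqI)+
  qed
  have carrier_coh: "carrier (cohomology_ring (gamma :: 'n jet_algebra \<Rightarrow> _))
      = cohomology_class gamma ` {x. gamma x = 0}"
    unfolding cohomology_ring_def FactRing_def A_RCOSETS_def' carrier[symmetric]
    by (auto simp: cohomology_class_def)
  have "inj_on (cohomology_class gamma) poly"
  proof (rule inj_onI)
    fix x y assume "x \<in> poly" "y \<in> poly" "cohomology_class gamma x = cohomology_class gamma y"
    then have "x - y \<in> range gamma" "x - y \<in> poly"
      using subspace_diff[OF hull_subalgebra(1)] by (simp_all add: eq_iff poly_def)
    then show "x = y" using poly_exact_zero[of "x - y"] by simp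
  qed
  moreover have "cohomology_class gamma ` poly = cohomology_class gamma ` {x. gamma x = 0}"
  proof (intro subset_antisym image_subsetI)
    fix x assume "x \<in> poly"
    then show "cohomology_class gamma x \<in> cohomology_class gamma ` {x. gamma x = 0}"
      by (intro imageI) (simp add: d_poly)
  next
    fix x :: "'n jet_algebra" assume "x \<in> {x. gamma x = 0}"
    then obtain p where "p \<in> poly" "x - p \<in> range gamma"
      using closed_decomposition[of x] by blast
    then show "cohomology_class gamma x \<in> cohomology_class gamma ` poly"
      by (intro image_eqI[of _ _ p]) (simp_all only: eq_iff)
  qed
  \<comment> \<open>\<open>poly\<close> consists of cocycles and carries the same operations as the
    cocycle ring, so the quotient map restricts to it.\<close>
  moreover have "cohomology_class gamma \<in> ring_hom (subset_ring poly) (cohomology_ring gamma)"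
    using hom d_poly unfolding ring_hom_def
    by (auto simp: cocycle_ring_def subset_ring_def)
  ultimately show ?thesis
    unfolding ring_iso_def bij_betw_def carrier_coh
    by (simp add: subset_ring_def poly_def)
qed

section \<open>The homotopy on jet variables\<close>

abbreviation T_var :: "'n multiset \<Rightarrow> 'n \<Rightarrow> 'n \<Rightarrow> 'n \<Rightarrow> 'n jet_algebra" where
  "T_var M a b c \<equiv> var (FieldT a b c, M)"

text \<open>The combination of the ghosts with \<open>\<gamma> X_{ab} = \<partial>_a C_b\<close>; it has no index symmetry.\<close>

definition X_var :: "'n multiset \<Rightarrow> 'n \<Rightarrow> 'n \<Rightarrow> 'n jet_algebra" where
  "X_var M a b = (1 / 6) *\<^sub>R var (GhostS a b, M) + (1 / 2) *\<^sub>R var (GhostA a b, M)"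

definition R_var :: "'n multiset \<Rightarrow> 'n \<Rightarrow> 'n \<Rightarrow> 'n \<Rightarrow> 'n jet_algebra" where
  "R_var M a b c = X_var (add_mset a M) b c - X_var (add_mset b M) a c"

text \<open>The jets of \<open>F_A\<close>: in the cyclic sum of the curl \<open>R_var\<close> the
  symmetric part of \<open>X\<close> drops out, leaving the exterior derivative of \<open>A\<close>
  up to a factor.\<close>

definition F_var :: "'n multiset \<Rightarrow> 'n \<Rightarrow> 'n \<Rightarrow> 'n \<Rightarrow> 'n jet_algebra" where
  "F_var M a b c = (1 / 3) *\<^sub>R (R_var M a b c + R_var M b c a + R_var M c a b)"

text \<open>\<open>D\<close> is the curl of \<open>T\<close> in the first pair of indices, and \<open>K\<close>, the curl of \<open>D\<close> in the last
  index, is the linearized curvature.\<close>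

definition D_var :: "'n multiset \<Rightarrow> 'n \<Rightarrow> 'n \<Rightarrow> 'n \<Rightarrow> 'n \<Rightarrow> 'n jet_algebra" where
  "D_var M a b c e = T_var (add_mset a M) b c e + T_var (add_mset b M) c a e + T_var (add_mset c M) a b e"

definition K_var :: "'n multiset \<Rightarrow> 'n \<Rightarrow> 'n \<Rightarrow> 'n \<Rightarrow> 'n \<Rightarrow> 'n \<Rightarrow> 'n jet_algebra" where
  "K_var M a b c e f = D_var (add_mset f M) a b c e - D_var (add_mset e M) a b c f"

lemmas linear_rules = linear_add linear_diff linear_neg linear_scale linear_0

lemma gamma_X_var: "gamma (X_var M a b) = var (GhostC b, add_mset a M)"
proof (rule linear_functional_eqI)
  fix \<phi> :: "'a jet_algebra \<Rightarrow> real" assume \<phi>: "linear \<phi>"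
  then show "\<phi> (gamma (X_var M a b)) = \<phi> (var (GhostC b, add_mset a M))"
    by (simp add: X_var_def gamma_gamma_var linear_rules)
qed

lemma GhostS_eq: "var (GhostS a b, M) = 3 *\<^sub>R (X_var M a b + X_var M b a)"
  using var_S_sym[of a b M] var_A_antisym[of a b M]
  by (simp add: X_var_def algebra_simps flip: scaleR_add_left)

lemma GhostA_eq: "var (GhostA a b, M) = X_var M a b - X_var M b a"
  using var_S_sym[of a b M] var_A_antisym[of a b M]
  by (simp add: X_var_def algebra_simps flip: scaleR_add_left)

text \<open>Since \<open>T\<close> has no totally antisymmetric part, only the curl of
  \<open>X\<close> with that part removed can appear.\<close>

lemma gamma_T_var: "gamma (T_var M a b c) = 6 *\<^sub>R (R_var M a b c - F_var M a b c)"
proof (rule linear_functional_eqI)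
  fix \<phi> :: "'a jet_algebra \<Rightarrow> real" assume \<phi>: "linear \<phi>"
  show "\<phi> (gamma (T_var M a b c)) = \<phi> (6 *\<^sub>R (R_var M a b c - F_var M a b c))"
    unfolding gamma_gamma_var gamma_var.simps GhostS_eq GhostA_eq R_var_def F_var_def
    by (simp add: linear_rules[OF \<phi>]; simp add: field_simps)
qed

lemma partial_X_var: "partial e (X_var M a b) = X_var (add_mset e M) a b"
  by (simp add: X_var_def partial_var)

lemma F_var_F_A: "F_A a b c = F_var {#} a b c"
proof (rule linear_functional_eqI)
  fix \<phi> :: "'a jet_algebra \<Rightarrow> real" assume \<phi>: "linear \<phi>"
  show "\<phi> (F_A a b c) = \<phi> (F_var {#} a b c)"
    unfolding F_A_def partial_var GhostA_eq R_var_def F_var_def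
    by (simp add: linear_rules[OF \<phi>] partial_X_var)
qed

lemma gamma_F_var: "gamma (F_var M a b c) = 0"
proof (rule linear_functional_eqI)
  fix \<phi> :: "'a jet_algebra \<Rightarrow> real" assume \<phi>: "linear \<phi>"
  show "\<phi> (gamma (F_var M a b c)) = \<phi> 0"
    unfolding R_var_def F_var_def
    by (simp add: linear_rules[OF \<phi>] gamma_X_var add_mset_commute)
qed

text \<open>Taking the curl of \<open>gamma_T_var\<close> removes \<open>R_var\<close>, itself a
  curl, and the Bianchi identity for \<open>F\<close> gathers the remaining terms into one
  derivative of \<open>F\<close>. So every differentiated \<open>F\<close> is exact.\<close>

lemma gamma_D_var: "gamma (D_var M a b c e) = - 6 *\<^sub>R F_var (add_mset e M) a b c"
proof (rule linear_functional_eqI)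
  fix \<phi> :: "'a jet_algebra \<Rightarrow> real" assume \<phi>: "linear \<phi>"
  show "\<phi> (gamma (D_var M a b c e)) = \<phi> (- 6 *\<^sub>R F_var (add_mset e M) a b c)"
    unfolding D_var_def gamma_add gamma_T_var R_var_def F_var_def
    by (simp add: linear_rules[OF \<phi>] add_mset_commute; simp add: field_simps)
qed

lemma gamma_K_var: "gamma (K_var M a b c e f) = 0"
  by (simp add: K_var_def gamma_D_var add_mset_commute)

text \<open>The cyclic identity makes the total antisymmetrization of a first derivative of
  \<open>T\<close> over its four indices vanish.\<close>

lemma D_var_bianchi: "D_var M a b c i = D_var M i b c a + D_var M i c a b + D_var M i a b c"
proof (rule linear_functional_eqI)
  fix \<phi> :: "'a jet_algebra \<Rightarrow> real" assume \<phi>: "linear \<phi>"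
  have anti: "\<phi> (T_var L y x z) = - \<phi> (T_var L x y z)" for L x y z
    unfolding var_T_antisym[of y x z L] by (simp add: linear_neg[OF \<phi>])
  have cyc: "\<phi> (T_var L x y z) + \<phi> (T_var L z x y) + \<phi> (T_var L y z x) = 0" for L x y z
    using arg_cong[OF var_T_cyclic[of x y z L], of \<phi>] by (simp add: linear_rules[OF \<phi>])
  show "\<phi> (D_var M a b c i) = \<phi> (D_var M i b c a + D_var M i c a b + D_var M i a b c)"
    unfolding D_var_def linear_add[OF \<phi>]
    using cyc[of b c i "add_mset a M"] cyc[of c a i "add_mset b M"] cyc[of a b i "add_mset c M"]
      cyc[of a b c "add_mset i M"]
      anti[of i c b "add_mset a M"] anti[of i a c "add_mset b M"] anti[of i b a "add_mset c M"] 
      anti[of i b c "add_mset a M"] anti[of i c a "add_mset b M"] anti[of i a b "add_mset c M"] 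
    by linarith
qed

lemma D_var_swap: "D_var M a c b e = - D_var M a b c e" "D_var M b a c e = - D_var M a b c e"
  unfolding D_var_def using var_T_antisym[of a b e] var_T_antisym[of b c e] var_T_antisym[of a c e]
  by simp_all

text \<open>
  With \<open>n\<close> the size of \<open>M\<close>: for \<open>n = 1\<close> the inner sum is empty, and for \<open>n = 0\<close> the outer one,
  so that the junk value of the division by \<open>n - 1\<close>, or by \<open>n\<close> in \<open>C_homotopy\<close>, is harmless.
\<close>

definition X_homotopy :: "'n multiset \<Rightarrow> 'n \<Rightarrow> 'n \<Rightarrow> 'n jet_algebra" where
  "X_homotopy M a b = (1 / (6 * (real (size M) + 1))) *\<^sub>R
     (\<Sum>i\<in>#M. T_var (M - {#i#}) i a b -
       (1 / (real (size M) - 1)) *\<^sub>R (\<Sum>j\<in>#M - {#i#}. D_var (M - {#i#} - {#j#}) i a b j))"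

definition C_homotopy :: "'n multiset \<Rightarrow> 'n \<Rightarrow> 'n jet_algebra" where
  "C_homotopy M b = (1 / real (size M)) *\<^sub>R (\<Sum>i\<in>#M. X_var (M - {#i#}) i b)"

text \<open>The values on \<open>S\<close> and \<open>A\<close> mirror \<open>GhostS_eq\<close> and
  \<open>GhostA_eq\<close>, so that the derivation sends \<open>X_var\<close> to
  \<open>X_homotopy\<close>.\<close>

fun homotopy_var :: "'n jet \<Rightarrow> 'n jet_algebra" where
  "homotopy_var (GhostS a b, M) = 3 *\<^sub>R (X_homotopy M a b + X_homotopy M b a)"
| "homotopy_var (GhostA a b, M) = X_homotopy M a b - X_homotopy M b a"
| "homotopy_var (GhostC b, M) = C_homotopy M b"
| "homotopy_var _ = 0"

lemma index_symmetric_homotopy_var: "index_symmetric homotopy_var"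
  by (simp add: index_symmetric_def add.commute)

lemma subspace_sum_mset:
  "subspace V \<Longrightarrow> (\<And>i. i \<in># M \<Longrightarrow> f i \<in> V) \<Longrightarrow> (\<Sum>i\<in>#M. f i) \<in> V"
  by (induction M) (auto simp: subspace_0 subspace_add)

lemma homotopy_var_graded_central:
  "homotopy_var g \<in> graded_central (\<not> odd_field (fst g))"
proof -
  note sub = subspace_graded_central
  have T: "T_var M a b c \<in> graded_central False" for M a b c
    by (rule var_graded_central) simp
  then have D: "D_var M a b c e \<in> graded_central False" for M a b c e
    unfolding D_var_def by (intro subspace_add[OF sub])
  have X: "X_var M a b \<in> graded_central True" for M a b
    unfolding X_var_def
    by (intro subspace_add[OF sub] subspace_scale[OF sub] var_graded_central) simp_all
  have "X_homotopy M a b \<in> graded_central False" for M a b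
    unfolding X_homotopy_def
    by (intro subspace_scale[OF sub] subspace_sum_mset[OF sub] subspace_diff[OF sub] T D)
  moreover have "C_homotopy M b \<in> graded_central True" for M b
    unfolding C_homotopy_def
    by (intro subspace_scale[OF sub] subspace_sum_mset[OF sub] X)
  ultimately show ?thesis
    by (cases g rule: homotopy_var.cases)
      (auto intro!: subspace_add[OF sub] subspace_diff[OF sub] subspace_scale[OF sub] subspace_0[OF sub])
qed


section \<open>Homotopy formula on the jets of the ghosts\<close>

lemma sum_mset_cong: "(\<And>i. i \<in># M \<Longrightarrow> f i = g i) \<Longrightarrow> (\<Sum>i\<in>#M. f i) = (\<Sum>i\<in>#M. g i)"
  by (metis image_mset_cong)

lemma sum_mset_const: "(\<Sum>i\<in>#M. x) = real (size M) *\<^sub>R (x :: 'b::real_vector)"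
  by (induction M) (simp_all add: algebra_simps)

lemma sum_mset_remove_const:
  "(\<Sum>i\<in>#M. \<Sum>j\<in>#M - {#i#}. f i) = (real (size M) - 1) *\<^sub>R (\<Sum>i\<in>#M. f i :: 'b::real_vector)"
proof -
  have "(\<Sum>i\<in>#M. \<Sum>j\<in>#M - {#i#}. f i) = (\<Sum>i\<in>#M. (real (size M) - 1) *\<^sub>R f i)"
  proof (rule sum_mset_cong)
    fix i assume "i \<in># M"
    then have "real (size (M - {#i#})) = real (size M) - 1"
      by (cases "size M") (auto simp: size_Diff_singleton)
    then show "(\<Sum>j\<in>#M - {#i#}. f i) = (real (size M) - 1) *\<^sub>R f i"
      by (simp only: sum_mset_const)
  qed
  then show ?thesis
    by (simp add: linear_sum_mset[of "\<lambda>x. (real (size M) - 1) *\<^sub>R x"] linear_scale_self)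
qed

lemma scaleR_sum_mset: "r *\<^sub>R (\<Sum>i\<in>#M. f i) = (\<Sum>i\<in>#M. r *\<^sub>R (f i :: 'b::real_vector))"
  by (rule linear_sum_mset) (rule linear_scale_self)

lemma gamma_sum_mset: "gamma (\<Sum>i\<in>#M. f i) = (\<Sum>i\<in>#M. gamma (f i))"
  by (rule linear_sum_mset) (simp add: linearI)

lemma sum_mset_subtractf:
  "(\<Sum>i\<in>#M. f i - g i :: 'b::ab_group_add) = (\<Sum>i\<in>#M. f i) - (\<Sum>i\<in>#M. g i)"
  by (induction M) simp_all

text \<open>The \<open>D_var\<close> correction serves to cancel the \<open>F_var\<close> part of
  \<open>gamma_T_var\<close>. With a single derivative index there is no correction and
  \<open>F\<close> survives, hence the hypothesis.\<close>

lemma gamma_X_homotopy: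
  assumes "size M \<noteq> 1"
  shows "gamma (X_homotopy M a b) =
    (1 / (real (size M) + 1)) *\<^sub>R (\<Sum>i\<in>#M. R_var (M - {#i#}) i a b)"
proof -
  define n where "n = real (size M)"
  have n: "n \<noteq> 1" using assms by (simp add: n_def)
  have "gamma (X_homotopy M a b) = (1 / (6 * (n + 1))) *\<^sub>R
      ((\<Sum>i\<in>#M. gamma (T_var (M - {#i#}) i a b)) - (1 / (n - 1)) *\<^sub>R
        (\<Sum>i\<in>#M. \<Sum>j\<in>#M - {#i#}. gamma (D_var (M - {#i#} - {#j#}) i a b j)))"
    by (simp add: X_homotopy_def gamma_sum_mset n_def sum_mset_subtractf scaleR_sum_mset)
  also have "(\<Sum>i\<in>#M. \<Sum>j\<in>#M - {#i#}. gamma (D_var (M - {#i#} - {#j#}) i a b j))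
      = (\<Sum>i\<in>#M. \<Sum>j\<in>#M - {#i#}. - 6 *\<^sub>R F_var (M - {#i#}) i a b)"
    by (intro sum_mset_cong) (simp add: gamma_D_var del: diff_diff_add_mset)
  \<comment> \<open>The summand does not depend on \<open>j\<close>, which runs over
    \<open>n - 1\<close> entries; this explains the weight in \<open>X_homotopy\<close>.\<close>
  also have "\<dots> = (n - 1) *\<^sub>R (\<Sum>i\<in>#M. - 6 *\<^sub>R F_var (M - {#i#}) i a b)"
    by (simp only: sum_mset_remove_const n_def)
  also have "(\<Sum>i\<in>#M. gamma (T_var (M - {#i#}) i a b))
      - (1 / (n - 1)) *\<^sub>R (n - 1) *\<^sub>R (\<Sum>i\<in>#M. - 6 *\<^sub>R F_var (M - {#i#}) i a b)
      = (\<Sum>i\<in>#M. 6 *\<^sub>R R_var (M - {#i#}) i a b)"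
    using n by (simp add: gamma_T_var flip: sum_mset_subtractf) (simp add: algebra_simps)
  also have "(1 / (6 * (n + 1))) *\<^sub>R \<dots> = (1 / (n + 1)) *\<^sub>R (\<Sum>i\<in>#M. R_var (M - {#i#}) i a b)"
  proof -
    have "1 / (6 * (n + 1)) * 6 = 1 / (n + 1)" by (simp add: field_simps n_def)
    then show ?thesis by (simp only: scaleR_sum_mset[symmetric] scaleR_scaleR)
  qed
  finally show ?thesis by (simp add: n_def)
qed

lemma C_homotopy_add_mset:
  "C_homotopy (add_mset a M) b = (1 / (real (size M) + 1)) *\<^sub>R
     (X_var M a b + (\<Sum>i\<in>#M. X_var (add_mset a (M - {#i#})) i b))"
proof -
  have "(\<Sum>i\<in>#M. X_var (add_mset a M - {#i#}) i b) = (\<Sum>i\<in>#M. X_var (add_mset a (M - {#i#})) i b)"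
    by (intro sum_mset_cong) simp
  then show ?thesis by (simp add: C_homotopy_def add.commute)
qed

text \<open>Each curl is \<open>X_var M a b\<close> minus a jet in which \<open>a\<close> and
  \<open>i\<close> are exchanged. The exchanged jets cancel against \<open>C_homotopy\<close>, whose
  own term brings the \<open>size M\<close> copies of \<open>X_var M a b\<close> to
  \<open>size M + 1\<close>.\<close>

lemma X_homotopy_formula:
  assumes "size M \<noteq> 1"
  shows "X_var M a b = gamma (X_homotopy M a b) + C_homotopy (add_mset a M) b"
proof -
  have "(\<Sum>i\<in>#M. R_var (M - {#i#}) i a b)
     = (\<Sum>i\<in>#M. X_var M a b) - (\<Sum>i\<in>#M. X_var (add_mset a (M - {#i#})) i b)"
    unfolding sum_mset_subtractf[symmetric] by (intro sum_mset_cong) (simp add: R_var_def)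
  also have "(\<Sum>i\<in>#M. X_var M a b) = real (size M) *\<^sub>R X_var M a b"
    by (rule sum_mset_const)
  finally have eq: "(\<Sum>i\<in>#M. R_var (M - {#i#}) i a b)
     = real (size M) *\<^sub>R X_var M a b - (\<Sum>i\<in>#M. X_var (add_mset a (M - {#i#})) i b)" .
  have "gamma (X_homotopy M a b) + C_homotopy (add_mset a M) b
     = (1 / (real (size M) + 1)) *\<^sub>R ((real (size M) + 1) *\<^sub>R X_var M a b)"
    unfolding gamma_X_homotopy[OF assms] C_homotopy_add_mset eq by (simp add: algebra_simps)
  then show ?thesis by simp
qed

text \<open>The exceptional order, where \<open>F_A\<close> enters the cohomology.\<close>

lemma X_homotopy_formula_single:
  "X_var {#d#} a b = gamma (X_homotopy {#d#} a b) + C_homotopy {#a, d#} b + (1 / 2) *\<^sub>R F_var {#} d a b"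
proof (rule linear_functional_eqI)
  fix \<phi> :: "'a jet_algebra \<Rightarrow> real" assume \<phi>: "linear \<phi>"
  show "\<phi> (X_var {#d#} a b) = \<phi> (gamma (X_homotopy {#d#} a b) + C_homotopy {#a, d#} b + (1 / 2) *\<^sub>R F_var {#} d a b)"
    unfolding X_homotopy_def C_homotopy_add_mset
    by (simp add: linear_rules[OF \<phi>] gamma_T_var R_var_def; simp add: field_simps)
qed

lemma C_homotopy_formula: "M \<noteq> {#} \<Longrightarrow> gamma (C_homotopy M b) = var (GhostC b, M)"
proof -
  assume M: "M \<noteq> {#}"
  have "(\<Sum>i\<in>#M. gamma (X_var (M - {#i#}) i b)) = (\<Sum>i\<in>#M. var (GhostC b, M))"
    by (intro sum_mset_cong) (simp add: gamma_X_var)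
  also have "\<dots> = real (size M) *\<^sub>R var (GhostC b, M)"
    by (rule sum_mset_const)
  finally show ?thesis using M by (simp add: C_homotopy_def gamma_sum_mset)
qed


section \<open>Homotopy formula on the jets of \<open>T\<close>\<close>

definition D_sum where
  "D_sum M a b c = (\<Sum>i\<in>#M. D_var (M - {#i#}) i b c a)"

definition K_sum where
  "K_sum M a b c = (\<Sum>i\<in>#M. \<Sum>j\<in>#M - {#i#}. K_var (M - {#i#} - {#j#}) i b c j a)"

text \<open>By \<open>D_var_bianchi\<close> this is the mean of
  \<open>D_var (M - {#j#}) a b c j\<close> over \<open>j\<close>, in a form that makes its cyclic
  invariance visible.\<close>

definition D_mean where
  "D_mean M a b c = (1 / real (size M)) *\<^sub>R (D_sum M a b c + D_sum M b c a + D_sum M c a b)"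

definition T_sum where
  "T_sum M a b c = (\<Sum>i\<in>#M. T_var (add_mset a (M - {#i#})) i b c)"

text \<open>Splits off the index \<open>a\<close> in both sums and exchanges it with
  \<open>j\<close> in \<open>D_var\<close>, at the price of a curvature
  \<open>K_var\<close>.\<close>

lemma X_homotopy_add_mset:
  "(6 * (real (size M) + 2)) *\<^sub>R X_homotopy (add_mset a M) b c =
    T_var M a b c + T_sum M a b c - D_mean M a b c - D_sum M a b c
    - (1 / real (size M)) *\<^sub>R K_sum M a b c"
proof -
  define k where "k = real (size M)"
  define rk where "rk = 1 / k"
  let ?D = "\<lambda>i. D_var (M - {#i#}) i b c a"
  have inner: "(\<Sum>j\<in>#add_mset a (M - {#i#}). D_var (add_mset a (M - {#i#}) - {#j#}) i b c j)
      = ?D i + ((\<Sum>j\<in>#M - {#i#}. K_var (M - {#i#} - {#j#}) i b c j a) + (\<Sum>j\<in>#M - {#i#}. ?D i))"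
    (is "?l = _") for i
  proof -
    have "(\<Sum>j\<in>#M - {#i#}. D_var (add_mset a (M - {#i#}) - {#j#}) i b c j)
      = (\<Sum>j\<in>#M - {#i#}. K_var (M - {#i#} - {#j#}) i b c j a + ?D i)"
      by (intro sum_mset_cong) (simp add: K_var_def del: diff_diff_add_mset)
    then show ?thesis by (simp add: sum_mset.distrib)
  qed
  have "X_homotopy (add_mset a M) b c = (1 / (6 * (k + 2))) *\<^sub>R
     (T_var M a b c - rk *\<^sub>R (\<Sum>j\<in>#M. D_var (M - {#j#}) a b c j)
      + (\<Sum>i\<in>#M. T_var (add_mset a M - {#i#}) i b c - rk *\<^sub>R
          (\<Sum>j\<in>#add_mset a M - {#i#}. D_var (add_mset a M - {#i#} - {#j#}) i b c j)))"
    by (simp add: X_homotopy_def k_def rk_def add.commute)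
  also have "(\<Sum>i\<in>#M. T_var (add_mset a M - {#i#}) i b c - rk *\<^sub>R
          (\<Sum>j\<in>#add_mset a M - {#i#}. D_var (add_mset a M - {#i#} - {#j#}) i b c j))
     = (\<Sum>i\<in>#M. T_var (add_mset a (M - {#i#})) i b c - rk *\<^sub>R
          (?D i + ((\<Sum>j\<in>#M - {#i#}. K_var (M - {#i#} - {#j#}) i b c j a) + (\<Sum>j\<in>#M - {#i#}. ?D i))))"
    unfolding inner[symmetric] by (intro sum_mset_cong) simp
  also have "\<dots> = T_sum M a b c - rk *\<^sub>R (D_sum M a b c + (K_sum M a b c + (k - 1) *\<^sub>R D_sum M a b c))"
    unfolding sum_mset_subtractf sum_mset.distrib scaleR_sum_mset[symmetric] T_sum_def D_sum_def K_sum_def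
      sum_mset_remove_const k_def ..
  also have "\<dots> = T_sum M a b c - rk *\<^sub>R K_sum M a b c - (rk * k) *\<^sub>R D_sum M a b c"
    by (simp add: algebra_simps)
  \<comment> \<open>For empty \<open>M\<close> the factor is 0 by the convention for division, but
    then \<open>D_sum\<close> is an empty sum.\<close>
  also have "(rk * k) *\<^sub>R D_sum M a b c = D_sum M a b c"
    by (cases "M = {#}") (simp_all add: rk_def k_def D_sum_def)
  also have "(\<Sum>j\<in>#M. D_var (M - {#j#}) a b c j) = D_sum M a b c + D_sum M b c a + D_sum M c a b"
    unfolding D_sum_def sum_mset.distrib[symmetric] by (intro sum_mset_cong D_var_bianchi)
  finally have "(6 * (k + 2)) *\<^sub>R X_homotopy (add_mset a M) b c = (6 * (k + 2) * (1 / (6 * (k + 2)))) *\<^sub>R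
     (T_var M a b c - D_mean M a b c + (T_sum M a b c - rk *\<^sub>R K_sum M a b c - D_sum M a b c))"
    by (simp only: scaleR_scaleR D_mean_def rk_def k_def)
  also have "6 * (k + 2) * (1 / (6 * (k + 2))) = 1"
    by (simp add: k_def)
  finally show ?thesis by (simp add: k_def rk_def algebra_simps)
qed

text \<open>On antisymmetrizing in \<open>a\<close> and \<open>b\<close>, the \<open>D_sum\<close>
  terms form \<open>D_mean\<close> up to \<open>D_sum M c a b\<close>. Expanding the latter by
  \<open>D_sum_T\<close> cancels the \<open>T_sum\<close> terms and yields the common factor
  \<open>k + 2\<close>.\<close>

lemma R_homotopy:
  "6 *\<^sub>R (X_homotopy (add_mset a M) b c - X_homotopy (add_mset b M) a c) =
    T_var M a b c - D_mean M a b c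
    - (1 / (real (size M) * (real (size M) + 2))) *\<^sub>R (K_sum M a b c - K_sum M b a c)"
proof -
  define k where "k = real (size M)"
  have k2: "k + 2 \<noteq> 0" by (simp add: k_def)
  let ?K = "K_sum M a b c - K_sum M b a c"
  define Q where "Q = (1 / (k * (k + 2))) *\<^sub>R ?K"
  have swap: "D_sum M z y x = - D_sum M z x y" for x y z
    unfolding D_sum_def D_var_swap(1)[of _ _ y x] by (rule linear_sum_mset[symmetric]) (simp add: linearI)
  have mean: "k *\<^sub>R D_mean M x y z = D_sum M x y z + D_sum M y z x + D_sum M z x y" for x y z
    by (cases "M = {#}") (simp_all add: D_mean_def k_def D_sum_def)
  have mean_swap: "D_mean M b a c = - D_mean M a b c"
    unfolding D_mean_def using swap[of a c b] swap[of b a c] swap[of c b a]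
    by (simp add: algebra_simps)
  have "D_sum M c a b = (\<Sum>i\<in>#M. (T_var M a b c - T_var (add_mset a (M - {#i#})) i b c)
      + T_var (add_mset b (M - {#i#})) i a c)"
    unfolding D_sum_def D_var_def by (intro sum_mset_cong) (simp add: var_T_antisym[of b])
  then have D_sum_T: "D_sum M c a b = k *\<^sub>R T_var M a b c - T_sum M a b c + T_sum M b a c"
    by (simp only: sum_mset.distrib sum_mset_subtractf sum_mset_const k_def T_sum_def)
  have "(k + 2) *\<^sub>R (6 *\<^sub>R (X_homotopy (add_mset a M) b c - X_homotopy (add_mset b M) a c))
    = (6 * (k + 2)) *\<^sub>R X_homotopy (add_mset a M) b c - (6 * (k + 2)) *\<^sub>R X_homotopy (add_mset b M) a c"
    by (simp add: algebra_simps)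
  also have "\<dots> = (k + 2) *\<^sub>R (T_var M a b c - D_mean M a b c - Q)"
    unfolding k_def X_homotopy_add_mset unfolding k_def[symmetric]
  proof (rule linear_functional_eqI)
    fix \<phi> :: "'a jet_algebra \<Rightarrow> real" assume \<phi>: "linear \<phi>"
    have "\<phi> (T_var M b a c) = - \<phi> (T_var M a b c)" "\<phi> (D_mean M b a c) = - \<phi> (D_mean M a b c)"
      "\<phi> (D_sum M b a c) = - \<phi> (D_sum M b c a)"
      unfolding mean_swap var_T_antisym[of b a c] swap[of b a c] by (simp_all add: linear_rules[OF \<phi>])
    moreover have "k * \<phi> (D_mean M a b c) = \<phi> (D_sum M a b c) + \<phi> (D_sum M b c a) + \<phi> (D_sum M c a b)"
      using arg_cong[OF mean, of \<phi>] by (simp add: linear_rules[OF \<phi>])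
    moreover have "\<phi> (D_sum M c a b) = k * \<phi> (T_var M a b c) - \<phi> (T_sum M a b c) + \<phi> (T_sum M b a c)"
      unfolding D_sum_T by (simp add: linear_rules[OF \<phi>])
    moreover have "(k + 2) * \<phi> Q = 1 / k * \<phi> (K_sum M a b c) - 1 / k * \<phi> (K_sum M b a c)"
    proof -
      have "(k + 2) * \<phi> Q = (k + 2) * (1 / (k * (k + 2))) * \<phi> ?K"
        by (simp add: Q_def linear_rules[OF \<phi>])
      also have "(k + 2) * (1 / (k * (k + 2))) = 1 / k" using k2 by simp
      finally show ?thesis by (simp add: linear_rules[OF \<phi>] right_diff_distrib diff_divide_distrib)
    qed
    ultimately show "\<phi> (T_var M a b c + T_sum M a b c - D_mean M a b c - D_sum M a b c - (1 / k) *\<^sub>R K_sum M a b c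
       - (T_var M b a c + T_sum M b a c - D_mean M b a c - D_sum M b a c - (1 / k) *\<^sub>R K_sum M b a c))
       = \<phi> ((k + 2) *\<^sub>R (T_var M a b c - D_mean M a b c - Q))"
      by (simp only: linear_rules[OF \<phi>] real_scaleR_def) (simp only: distrib_right right_diff_distrib; linarith)
  qed
  finally show ?thesis using scaleR_left_imp_eq[OF k2] unfolding Q_def k_def by blast
qed

text \<open>Subtracting the cyclic mean, as \<open>gamma_T_var\<close> does, leaves \<open>T\<close>
  intact by its cyclic identity and removes the cyclically invariant \<open>D_mean\<close>. Only
  curvatures remain.\<close>

lemma T_homotopy_formula:
  fixes \<delta> :: "'n jet_algebra \<Rightarrow> 'n jet_algebra"
  assumes "linear \<delta>" and \<delta>: "\<And>M a b. \<delta> (X_var M a b) = X_homotopy M a b"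
    and U: "subspace U" "\<And>M a b c e f. K_var M a b c e f \<in> U"
  shows "T_var M a b c - \<delta> (gamma (T_var M a b c)) \<in> U"
proof -
  define Q where "Q x y z = (1 / (real (size M) * (real (size M) + 2))) *\<^sub>R (K_sum M x y z - K_sum M y x z)" for x y z
  have R: "6 *\<^sub>R \<delta> (R_var M x y z) = T_var M x y z - D_mean M x y z - Q x y z" for x y z
    unfolding R_var_def linear_diff[OF assms(1)] \<delta> Q_def by (rule R_homotopy)
  have "T_var M a b c - \<delta> (gamma (T_var M a b c)) = Q a b c - (1 / 3) *\<^sub>R (Q a b c + Q b c a + Q c a b)"
  proof (rule linear_functional_eqI)
    fix \<phi> :: "'n jet_algebra \<Rightarrow> real" assume \<phi>: "linear \<phi>"
    have R\<phi>: "6 * \<phi> (\<delta> (R_var M x y z)) = \<phi> (T_var M x y z) - \<phi> (D_mean M x y z) - \<phi> (Q x y z)" for x y z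
      using arg_cong[OF R, of \<phi>] by (simp add: linear_rules[OF \<phi>])
    have mean: "D_mean M b c a = D_mean M a b c" "D_mean M c a b = D_mean M a b c"
      by (simp_all add: D_mean_def algebra_simps)
    have cyc: "\<phi> (T_var M a b c) + \<phi> (T_var M c a b) + \<phi> (T_var M b c a) = 0"
      using arg_cong[OF var_T_cyclic[of a b c M], of \<phi>] by (simp add: linear_rules[OF \<phi>])
    have "\<phi> (T_var M a b c - \<delta> (gamma (T_var M a b c))) = \<phi> (T_var M a b c) - 6 * \<phi> (\<delta> (R_var M a b c))
       + (1 / 3) * (6 * \<phi> (\<delta> (R_var M a b c)) + 6 * \<phi> (\<delta> (R_var M b c a)) + 6 * \<phi> (\<delta> (R_var M c a b)))"
      unfolding gamma_T_var F_var_def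
      by (simp add: linear_rules[OF \<phi>] linear_rules[OF assms(1)])
    also have "\<dots> = \<phi> (Q a b c - (1 / 3) *\<^sub>R (Q a b c + Q b c a + Q c a b))"
      unfolding R\<phi> mean using cyc by (simp add: linear_rules[OF \<phi>]) (simp add: field_simps)
    finally show "\<phi> (T_var M a b c - \<delta> (gamma (T_var M a b c))) =
       \<phi> (Q a b c - (1 / 3) *\<^sub>R (Q a b c + Q b c a + Q c a b))" .
  qed
  moreover have "Q x y z \<in> U" for x y z
    unfolding Q_def K_sum_def
    by (intro subspace_scale[OF U(1)] subspace_diff[OF U(1)] subspace_sum_mset[OF U(1)] U(2))
  ultimately show ?thesis
    by (simp add: subspace_diff subspace_scale subspace_add U(1))
qed

section \<open>The Young projection of the jets of \<open>T\<close>\<close>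

lemma sum_permutes_insert2:
  assumes "a \<noteq> b" "a \<notin> S" "b \<notin> S" "finite S"
  shows "(\<Sum>\<pi> | \<pi> permutes insert a (insert b S). f \<pi>)
    = (\<Sum>x\<in>insert a (insert b S). \<Sum>y\<in>insert b S. \<Sum>\<pi> | \<pi> permutes S.
        f (transpose a x \<circ> (transpose b y \<circ> \<pi>)))"
  using assms by (simp only: sum_over_permutations_insert finite_insert insert_iff simp_thms)

lemma antisymmetrize_two:
  assumes "p \<noteq> q"
  shows "antisymmetrize {p, q} t i = (1 / 2) *\<^sub>R (t i - t (i \<circ> transpose p q))"
  using assms by (simp add: antisymmetrize_def sum_over_permutations_insert sign_swap_id
      permutes_sing)

lemma antisymmetrize_three:
  assumes "p \<noteq> q" "p \<noteq> r" "q \<noteq> r"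
  shows "antisymmetrize {p, q, r} t i = (1 / 6) *\<^sub>R
    (t i - t (i \<circ> transpose q r) - t (i \<circ> transpose p q) + t (i \<circ> transpose p q \<circ> transpose q r)
     - t (i \<circ> transpose p r) + t (i \<circ> transpose p r \<circ> transpose q r))"
  using assms by (simp add: antisymmetrize_def sum_permutes_insert2 sign_swap_id
      permutes_sing sign_compose permutation_swap_id fact_numeral o_assoc)

lemma symmetrize_two:
  assumes "p \<noteq> q"
  shows "symmetrize {p, q} t i = (1 / 2) *\<^sub>R (t i + t (i \<circ> transpose p q))"
  using assms by (simp add: symmetrize_def sum_over_permutations_insert permutes_sing)

text \<open>Unlike \<^const>\<open>T_jet\<close>, this family is closed under permutations of the positions.\<close>

definition jet_at :: "nat \<Rightarrow> nat \<Rightarrow> nat \<Rightarrow> nat \<Rightarrow> (nat \<Rightarrow> 'n) \<Rightarrow> 'n jet_algebra" where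
  "jet_at k p q r i = T_var (image_mset i (mset_set ({..<k + 3} - {p, q, r}))) (i p) (i q) (i r)"

lemma T_jet_eq: "T_jet k = jet_at k 0 1 2"
proof
  fix i :: "nat \<Rightarrow> 'n"
  have "{..<k + 3} - {0, 1, 2} = {3..<k + 3}" by auto
  then show "T_jet k i = jet_at k 0 1 2 i"
    by (simp add: T_jet_def jet_at_def del: upt_Suc flip: mset_set_upto_eq_mset_upto)
qed

text \<open>Derivative positions enter only as a multiset, so a permutation is felt only through the
  images of the three field positions.\<close>

lemma jet_at_comp:
  assumes "\<sigma> permutes {..<k + 3}"
  shows "jet_at k p q r (i \<circ> \<sigma>) = jet_at k (\<sigma> p) (\<sigma> q) (\<sigma> r) i"
proof -
  have "image_mset (i \<circ> \<sigma>) (mset_set ({..<k + 3} - {p, q, r}))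
      = image_mset i (image_mset \<sigma> (mset_set ({..<k + 3} - {p, q, r})))"
    by (simp add: multiset.map_comp)
  also have "image_mset \<sigma> (mset_set ({..<k + 3} - {p, q, r})) = mset_set (\<sigma> ` ({..<k + 3} - {p, q, r}))"
    by (rule image_mset_mset_set) (metis assms inj_on_subset permutes_inj subset_UNIV)
  also have "\<sigma> ` ({..<k + 3} - {p, q, r}) = {..<k + 3} - {\<sigma> p, \<sigma> q, \<sigma> r}"
    using permutes_image[OF assms] by (simp add: image_set_diff[OF permutes_inj[OF assms]])
  finally have eq: "image_mset (i \<circ> \<sigma>) (mset_set ({..<k + 3} - {p, q, r}))
      = image_mset i (mset_set ({..<k + 3} - {\<sigma> p, \<sigma> q, \<sigma> r}))" .
  show ?thesis unfolding jet_at_def eq by simp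
qed

lemma transpose_permutes: "p < n \<Longrightarrow> q < n \<Longrightarrow> transpose p q permutes {..<n::nat}"
  by (rule permutes_swap_id) simp_all

text \<open>Permutations of the row with the same images of positions 0 and 2 give the same jet.
  There are \<open>(k - 2)!\<close> for each pair of images, which leaves
  \<open>1 / (k (k - 1))\<close>.\<close>

lemma symmetrize_row:
  assumes "k \<ge> 2"
  shows "symmetrize ({0, 2} \<union> {3..k}) (T_jet k) j = (1 / (real k * (real k - 1))) *\<^sub>R
    (\<Sum>b\<in>insert 0 (insert 2 {3..k}). \<Sum>c\<in>insert 2 {3..k}. jet_at k b 1 (transpose 0 b c) j)"
proof -
  have [simp]: "card (insert 0 (insert 2 {3..k})) = k" using assms by simp
  \<comment> \<open>The composite sends 0 to \<open>b\<close> and 2 to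
    \<open>transpose 0 b c\<close>, because \<open>\<pi>\<close> fixes 0, 1 and 2.\<close>
  have perm: "T_jet k (j \<circ> (transpose 0 b \<circ> (transpose 2 c \<circ> \<pi>))) = jet_at k b 1 (transpose 0 b c) j"
    if b: "b \<in> insert 0 (insert 2 {3..k})" and c: "c \<in> insert 2 {3..k}" and \<pi>: "\<pi> permutes {3..k}" for b c \<pi>
  proof -
    let ?\<sigma> = "transpose 0 b \<circ> (transpose 2 c \<circ> \<pi>)"
    have "\<pi> permutes {..<k + 3}" by (rule permutes_subset[OF \<pi>]) auto
    then have "?\<sigma> permutes {..<k + 3}"
      using b c assms by (intro permutes_compose transpose_permutes) auto
    moreover have "\<pi> 0 = 0" "\<pi> 1 = 1" "\<pi> 2 = 2"
      using \<pi> by (auto intro!: permutes_not_in[OF \<pi>])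
    moreover have "transpose 2 c 0 = 0" "transpose 2 c 1 = 1" "transpose 0 b 1 = 1"
      using b c by (auto simp: transpose_apply_other)
    ultimately show ?thesis by (simp add: T_jet_eq jet_at_comp)
  qed
  have "(\<Sum>\<pi> | \<pi> permutes insert 0 (insert 2 {3..k}). T_jet k (j \<circ> \<pi>))
    = (\<Sum>b\<in>insert 0 (insert 2 {3..k}). \<Sum>c\<in>insert 2 {3..k}. \<Sum>\<pi> | \<pi> permutes {3..k}.
        T_jet k (j \<circ> (transpose 0 b \<circ> (transpose 2 c \<circ> \<pi>))))"
    by (rule sum_permutes_insert2) auto
  also have "\<dots> = (\<Sum>b\<in>insert 0 (insert 2 {3..k}). \<Sum>c\<in>insert 2 {3..k}. \<Sum>\<pi> | \<pi> permutes {3..k}.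
       jet_at k b 1 (transpose 0 b c) j)"
    by (intro sum.cong[OF HOL.refl] perm) auto
  also have "\<dots> = (\<Sum>b\<in>insert 0 (insert 2 {3..k}). \<Sum>c\<in>insert 2 {3..k}. fact (k - 2) *\<^sub>R jet_at k b 1 (transpose 0 b c) j)"
    by (simp only: sum_constant_scaleR card_permutations[OF HOL.refl finite_atLeastAtMost] card_atLeastAtMost) simp
  finally have "symmetrize ({0, 2} \<union> {3..k}) (T_jet k) j = (1 / fact k) *\<^sub>R (fact (k - 2) *\<^sub>R
     (\<Sum>b\<in>insert 0 (insert 2 {3..k}). \<Sum>c\<in>insert 2 {3..k}. jet_at k b 1 (transpose 0 b c) j))"
    unfolding symmetrize_def Un_insert_left Un_empty_left
    by (simp only: \<open>card _ = k\<close> scaleR_sum_right)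
  moreover have "fact k = real k * (real k - 1) * fact (k - 2)"
    using assms fact_reduce[of k, where 'a=real] fact_reduce[of "k - 1", where 'a=real]
    by (simp add: of_nat_diff numeral_2_eq_2)
  ultimately show ?thesis by simp
qed

section \<open>Antisymmetrization over the columns\<close>

definition antisymmetrize_columns :: "nat \<Rightarrow> ((nat \<Rightarrow> 'n) \<Rightarrow> 'b::real_vector) \<Rightarrow> (nat \<Rightarrow> 'n) \<Rightarrow> 'b" where
  "antisymmetrize_columns k t = antisymmetrize {2, k + 1} (antisymmetrize {0, 1, k + 2} t)"

lemma antisymmetrize_sum: "antisymmetrize P (\<lambda>j. \<Sum>x\<in>S. f x j) = (\<lambda>i. \<Sum>x\<in>S. antisymmetrize P (f x) i)"
  unfolding antisymmetrize_def scaleR_sum_right by (intro ext sum.swap)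

lemma antisymmetrize_scaleR: "antisymmetrize P (\<lambda>j. r *\<^sub>R f j) = (\<lambda>i. r *\<^sub>R antisymmetrize P f i)"
  by (intro ext) (simp add: antisymmetrize_def scaleR_sum_right mult.commute)

lemma antisymmetrize_add: "antisymmetrize P (\<lambda>j. f j + g j) = (\<lambda>i. antisymmetrize P f i + antisymmetrize P g i)"
  by (intro ext) (simp add: antisymmetrize_def scaleR_sum_right scaleR_add_right sum.distrib)

lemma antisymmetrize_columns_jet_at:
  assumes "k \<ge> 2"
  shows "antisymmetrize_columns k (jet_at k p q r) i = (1 / 12) *\<^sub>R
   (let z = transpose 2 (k + 1); s = transpose 0 1; u = transpose 0 (k + 2); v = transpose 1 (k + 2);
      J = (\<lambda>\<sigma>. jet_at k (\<sigma> p) (\<sigma> q) (\<sigma> r) i) in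
    J id - J v - J s + J (s \<circ> v) - J u + J (u \<circ> v)
    - J z + J (z \<circ> v) + J (z \<circ> s) - J (z \<circ> s \<circ> v) + J (z \<circ> u) - J (z \<circ> u \<circ> v))"
proof -
  have *: "jet_at k p q r (j \<circ> transpose a b) = jet_at k (transpose a b p) (transpose a b q) (transpose a b r) j"
    if "a < k + 3" "b < k + 3" for a b p q r and j :: "nat \<Rightarrow> 'a"
    using that by (intro jet_at_comp transpose_permutes)
  show ?thesis
    using assms unfolding antisymmetrize_columns_def Let_def
    by (simp add: antisymmetrize_two antisymmetrize_three *) (simp add: algebra_simps)
qed


text \<open>Composition with the transposition pairs permutations of opposite sign on which
  \<open>t\<close> agrees.\<close>

lemma antisymmetrize_zero:
  fixes t :: "(nat \<Rightarrow> 'n) \<Rightarrow> 'b::real_vector"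
  assumes "finite P" "p \<in> P" "q \<in> P" "p \<noteq> q" and sym: "\<And>j. t (j \<circ> transpose p q) = t j"
  shows "antisymmetrize P t i = 0"
proof -
  let ?\<tau> = "transpose p q" and ?f = "\<lambda>\<pi>. of_int (sign \<pi>) *\<^sub>R t (i \<circ> \<pi>)"
  have \<tau>: "?\<tau> permutes P" using assms by (intro permutes_swap_id)
  have "sum ?f {\<pi>. \<pi> permutes P} = (\<Sum>\<pi> | \<pi> permutes P. ?f (\<pi> \<circ> ?\<tau>))"
    by (rule sum_permutations_compose_right[OF \<tau>])
  also have "\<dots> = (\<Sum>\<pi> | \<pi> permutes P. - ?f \<pi>)"
  proof (rule sum.cong[OF HOL.refl])
    fix \<pi> assume "\<pi> \<in> {\<pi>. \<pi> permutes P}"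
    then have "permutation \<pi>" using \<open>finite P\<close> by (auto simp: permutation_permutes)
    then have "sign (\<pi> \<circ> ?\<tau>) = - sign \<pi>"
      using \<open>p \<noteq> q\<close> by (simp add: sign_compose permutation_swap_id sign_swap_id)
    then show "?f (\<pi> \<circ> ?\<tau>) = - ?f \<pi>" using sym[of "i \<circ> \<pi>"] by (simp add: o_assoc)
  qed
  also have "\<dots> = - sum ?f {\<pi>. \<pi> permutes P}" by (rule sum_negf)
  finally have "sum ?f {\<pi>. \<pi> permutes P} = - sum ?f {\<pi>. \<pi> permutes P}" .
  moreover have "x = 0" if "x = - x" for x :: 'b
  proof -
    have "2 *\<^sub>R x = x + - x" using that by (simp only: scaleR_2)
    then show ?thesis by simp
  qed
  ultimately have "sum ?f {\<pi>. \<pi> permutes P} = 0" by blast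
  then show ?thesis by (simp add: antisymmetrize_def)
qed

lemma antisymmetrize_comp_transpose:
  assumes "p \<notin> P" "q \<notin> P" and sym: "\<And>j. t (j \<circ> transpose p q) = t j"
  shows "antisymmetrize P t (i \<circ> transpose p q) = antisymmetrize P t i"
  unfolding antisymmetrize_def
proof (intro arg_cong[of _ _ "(*\<^sub>R) (1 / fact (card P))"] sum.cong[OF HOL.refl])
  fix \<pi> assume "\<pi> \<in> {\<pi>. \<pi> permutes P}"
  then have \<pi>: "\<pi> permutes P" by simp
  have fixed: "\<pi> p = p" "\<pi> q = q" using assms(1,2) permutes_not_in[OF \<pi>] by auto
  have "transpose p q \<circ> \<pi> = \<pi> \<circ> transpose p q"
  proof
    fix x show "(transpose p q \<circ> \<pi>) x = (\<pi> \<circ> transpose p q) x"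
      using fixed inj_eq[OF permutes_inj[OF \<pi>], of x p] inj_eq[OF permutes_inj[OF \<pi>], of x q]
      by (auto simp: transpose_def)
  qed
  then show "of_int (sign \<pi>) *\<^sub>R t (i \<circ> transpose p q \<circ> \<pi>) = of_int (sign \<pi>) *\<^sub>R t (i \<circ> \<pi>)"
    using sym[of "i \<circ> \<pi>"] by (simp add: o_assoc[symmetric])
qed

lemma jet_at_comp_transpose:
  assumes "x < k + 3" "y < k + 3" "x \<notin> {p, q, r}" "y \<notin> {p, q, r}"
  shows "jet_at k p q r (j \<circ> transpose x y) = jet_at k p q r j"
proof -
  have "transpose x y p = p" "transpose x y q = q" "transpose x y r = r"
    using assms(3,4) by (auto intro!: transpose_apply_other)
  then show ?thesis
    using jet_at_comp[OF transpose_permutes[OF assms(1,2)], of p q r j] by simp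
qed

text \<open>For the long column the inner antisymmetrization already vanishes. For the short one,
  the symmetry first has to pass through the inner antisymmetrization, which acts on other
  positions.\<close>

lemma antisymmetrize_columns_zero:
  assumes "k \<ge> 2" "{x, y} \<subseteq> {0, 1, k + 2} \<or> {x, y} = {2, k + 1}" "x \<noteq> y"
    "x \<notin> {p, q, r}" "y \<notin> {p, q, r}"
  shows "antisymmetrize_columns k (jet_at k p q r) i = 0"
proof -
  have "x < k + 3" "y < k + 3" using assms(2) by (auto simp: doubleton_eq_iff)
  then have sym: "jet_at k p q r (j \<circ> transpose x y) = jet_at k p q r j" for j :: "nat \<Rightarrow> 'a"
    using assms by (intro jet_at_comp_transpose)
  show ?thesis
  proof (cases "{x, y} \<subseteq> {0, 1, k + 2}")
    case True
    then have "antisymmetrize {0, 1, k + 2} (jet_at k p q r) = (\<lambda>j :: nat \<Rightarrow> 'a. 0)"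
      using sym assms(3) by (intro ext antisymmetrize_zero[of _ x y]) auto
    then show ?thesis unfolding antisymmetrize_columns_def by (simp add: antisymmetrize_def)
  next
    case False
    then have xy: "{x, y} = {2, k + 1}" using assms(2) by blast
    then have "x \<notin> {0, 1, k + 2}" "y \<notin> {0, 1, k + 2}"
      using assms(1) by (auto simp: doubleton_eq_iff)
    then show ?thesis
      unfolding antisymmetrize_columns_def xy[symmetric]
      using sym assms(3) by (intro antisymmetrize_zero[of _ x y] antisymmetrize_comp_transpose) auto
  qed
qed

lemma jet_at_columns:
  assumes "{p, q, r, u, v} = {0, 1, 2, k + 1, k + 2}" "distinct [p, q, r, u, v]" "k \<ge> 2"
  shows "jet_at k p q r i = T_var (add_mset (i u) (add_mset (i v) (image_mset i (mset_set {3..<k + 1})))) (i p) (i q) (i r)"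
proof -
  have "{..<k + 3} = {0, 1, 2, k + 1, k + 2} \<union> {3..<k + 1}" using assms(3) by auto
  moreover have notin: "x \<notin> {3..<k + 1}" if "x \<in> {p, q, r, u, v}" for x
    using that assms(3) unfolding assms(1) by auto
  moreover have "{p, q, r, u, v} \<union> {3..<k + 1} - {p, q, r} = insert u (insert v {3..<k + 1})"
    using assms(2) notin[of p] notin[of q] notin[of r] by auto
  ultimately have "{..<k + 3} - {p, q, r} = insert u (insert v {3..<k + 1})"
    unfolding assms(1)[symmetric] by simp
  then show ?thesis
    using assms(2) notin[of u] notin[of v] by (simp add: jet_at_def)
qed

text \<open>The twelve terms combine in pairs into the six of \<open>K\<close>. In the first case
  the pairs are equal by antisymmetry of \<open>T\<close>, giving \<open>2 / 12\<close>; in the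
  second the cyclic identity merges each pair into one term, giving \<open>1 / 12\<close>.\<close>

lemma antisymmetrize_columns_K:
  fixes i :: "nat \<Rightarrow> 'n"
  assumes k: "k \<ge> 2"
  defines "K \<equiv> K_var (image_mset i (mset_set {3..<k + 1})) (i 0) (i 1) (i (k + 2)) (i 2) (i (k + 1))"
  shows "antisymmetrize_columns k (jet_at k 0 1 2) i = (1 / 6) *\<^sub>R K"
    and "antisymmetrize_columns k (jet_at k 2 1 0) i = (1 / 12) *\<^sub>R K"
proof -
  define L where "L = image_mset i (mset_set {3..<k + 1})"
  \<comment> \<open>Opaque names with explicit disequalities let the simplifier evaluate the
    transpositions.\<close>
  define w where "w = k + 2"
  define z where "z = k + 1"
  have neq [simp]: "w \<noteq> 0" "w \<noteq> 1" "w \<noteq> Suc 0" "w \<noteq> 2" "w \<noteq> z" "z \<noteq> w" "z \<noteq> 0" "z \<noteq> 1" "z \<noteq> Suc 0" "z \<noteq> 2"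
    "0 \<noteq> w" "1 \<noteq> w" "Suc 0 \<noteq> w" "2 \<noteq> w" "0 \<noteq> z" "1 \<noteq> z" "Suc 0 \<noteq> z" "2 \<noteq> z"
    using k by (simp_all add: w_def z_def)
  define t where "t x f p q r = T_var (add_mset (i x) (add_mset (i f) L)) (i p) (i q) (i r)" for x f p q r
  have jet: "jet_at k p q r i = t x f p q r"
    if "{p, q, r, x, f} = {0, 1, 2, z, w}" "distinct [p, q, r, x, f]" for p q r x f
    unfolding t_def L_def using jet_at_columns[of p q r x f k i] that k by (simp add: w_def z_def)
  have J1:
      "jet_at k 0 1 2 i = t w z 0 1 2" "jet_at k 0 w 2 i = t 1 z 0 w 2" "jet_at k 1 0 2 i = t w z 1 0 2"
      "jet_at k 1 w 2 i = t 0 z 1 w 2" "jet_at k w 0 2 i = t 1 z w 0 2" "jet_at k w 1 2 i = t 0 z w 1 2"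
      "jet_at k 0 1 z i = t w 2 0 1 z" "jet_at k 0 w z i = t 1 2 0 w z" "jet_at k 1 0 z i = t w 2 1 0 z"
      "jet_at k 1 w z i = t 0 2 1 w z" "jet_at k w 0 z i = t 1 2 w 0 z" "jet_at k w 1 z i = t 0 2 w 1 z"
    by (rule jet; auto)+
  have J2:
      "jet_at k 2 0 1 i = t w z 2 0 1" "jet_at k 2 0 w i = t 1 z 2 0 w" "jet_at k 2 1 0 i = t w z 2 1 0"
      "jet_at k 2 1 w i = t 0 z 2 1 w" "jet_at k 2 w 0 i = t 1 z 2 w 0" "jet_at k 2 w 1 i = t 0 z 2 w 1"
      "jet_at k z 0 1 i = t w 2 z 0 1" "jet_at k z 0 w i = t 1 2 z 0 w" "jet_at k z 1 0 i = t w 2 z 1 0"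
      "jet_at k z 1 w i = t 0 2 z 1 w" "jet_at k z w 0 i = t 1 2 z w 0" "jet_at k z w 1 i = t 0 2 z w 1"
    by (rule jet; auto)+
  have K: "K = t 0 z 1 w 2 + t 1 z w 0 2 + t w z 0 1 2 - (t 0 2 1 w z + t 1 2 w 0 z + t w 2 0 1 z)"
    unfolding K_def K_var_def D_var_def t_def L_def w_def z_def ..
  have columns: "antisymmetrize_columns k (jet_at k p q r) i = (1 / 12) *\<^sub>R
    (let S = (\<lambda>\<sigma>. jet_at k (\<sigma> p) (\<sigma> q) (\<sigma> r) i); z = transpose 2 z; s = transpose 0 1; u = transpose 0 w; v = transpose 1 w in
    S id - S v - S s + S (s \<circ> v) - S u + S (u \<circ> v)
    - S z + S (z \<circ> v) + S (z \<circ> s) - S (z \<circ> s \<circ> v) + S (z \<circ> u) - S (z \<circ> u \<circ> v))" for p q r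
    unfolding antisymmetrize_columns_jet_at[OF k] Let_def w_def z_def ..
  have "antisymmetrize_columns k (jet_at k 0 1 2) i = (1 / 6) *\<^sub>R K \<and>
      antisymmetrize_columns k (jet_at k 2 1 0) i = (1 / 12) *\<^sub>R K"
  proof (intro conjI; rule linear_functional_eqI)
    fix \<phi> :: "'n jet_algebra \<Rightarrow> real" assume \<phi>: "linear \<phi>"
    have anti: "\<phi> (t x f q p r) = - \<phi> (t x f p q r)" for q p x f r
      unfolding t_def var_T_antisym[of "i q"] by (simp add: linear_neg[OF \<phi>])
    have cyc: "\<phi> (t x f p q r) + \<phi> (t x f r p q) + \<phi> (t x f q r p) = 0" for p q r x f
      using arg_cong[OF var_T_cyclic[of "i p" "i q" "i r"], of \<phi>] by (simp add: t_def linear_rules[OF \<phi>])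
    have "antisymmetrize_columns k (jet_at k 0 1 2) i = (1 / 12) *\<^sub>R
       (t w z 0 1 2 - t 1 z 0 w 2 - t w z 1 0 2 + t 0 z 1 w 2 - t 0 z w 1 2 + t 1 z w 0 2
        - t w 2 0 1 z + t 1 2 0 w z + t w 2 1 0 z - t 0 2 1 w z + t 0 2 w 1 z - t 1 2 w 0 z)"
      unfolding columns Let_def by (simp add: transpose_def J1[unfolded One_nat_def])
    then show "\<phi> (antisymmetrize_columns k (jet_at k 0 1 2) i) = \<phi> ((1 / 6) *\<^sub>R K)"
      using anti[of w z 1 0 2] anti[of 0 z w 1 2] anti[of 1 z 0 w 2]
      anti[of w 2 1 0 z] anti[of 0 2 w 1 z] anti[of 1 2 0 w z]
      by (simp add: K linear_rules[OF \<phi>])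
    have "antisymmetrize_columns k (jet_at k 2 1 0) i = (1 / 12) *\<^sub>R
       (t w z 2 1 0 - t 1 z 2 w 0 - t w z 2 0 1 + t 0 z 2 w 1 - t 0 z 2 1 w + t 1 z 2 0 w
        - t w 2 z 1 0 + t 1 2 z w 0 + t w 2 z 0 1 - t 0 2 z w 1 + t 0 2 z 1 w - t 1 2 z 0 w)"
      unfolding columns Let_def by (simp add: transpose_def J2[unfolded One_nat_def])
    then show "\<phi> (antisymmetrize_columns k (jet_at k 2 1 0) i) = \<phi> ((1 / 12) *\<^sub>R K)"
      using anti[of w z 1 2 0] cyc[of w z 0 1 2] anti[of 0 z w 2 1] cyc[of 0 z 1 w 2] anti[of 1 z 0 2 w] cyc[of 1 z w 0 2]
      anti[of w 2 1 z 0] cyc[of w 2 0 1 z] anti[of 0 2 w z 1] cyc[of 0 2 1 w z] anti[of 1 2 0 z w] cyc[of 1 2 w 0 z]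
      by (simp add: K linear_rules[OF \<phi>])
  qed
  then show "antisymmetrize_columns k (jet_at k 0 1 2) i = (1 / 6) *\<^sub>R K"
    and "antisymmetrize_columns k (jet_at k 2 1 0) i = (1 / 12) *\<^sub>R K" by blast+
qed


text \<open>
  A column containing two derivative indices is killed by the antisymmetrization. Of the terms of the
  row symmetrization only the identity survives, contributing \<open>K / 6\<close>, and the exchange of \<open>a\<close> and
  \<open>c\<close>, contributing half of that by the cyclic identity.
\<close>

lemma E_T_eq_K:
  assumes k: "k \<ge> 2"
  shows "E_T k i = (1 / (8 * real k * (real k - 1))) *\<^sub>R
    K_var (image_mset i (mset_set {3..<k + 1})) (i 0) (i 1) (i (k + 2)) (i 2) (i (k + 1))"
proof -
  let ?B = "insert 0 (insert 2 {3..k})" and ?C = "insert 2 {3..k}"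
  let ?c = "1 / (real k * (real k - 1))"
  let ?f = "\<lambda>q b c. antisymmetrize_columns k (jet_at k b q c) i"
  have swap: "jet_at k b 1 (transpose 0 b c) (j \<circ> transpose 1 (k + 1)) = jet_at k b (k + 1) (transpose 0 b c) j"
    if "b \<in> ?B" "c \<in> ?C" for b c and j :: "nat \<Rightarrow> 'a"
    using that k by (subst jet_at_comp) (auto simp: transpose_permutes transpose_def)
  have "symmetrize {1, k + 1} (symmetrize ({0, 2} \<union> {3..k}) (T_jet k)) j
    = (1 / 2) *\<^sub>R (?c *\<^sub>R (\<Sum>b\<in>?B. \<Sum>c\<in>?C. jet_at k b 1 (transpose 0 b c) j)
      + ?c *\<^sub>R (\<Sum>b\<in>?B. \<Sum>c\<in>?C. jet_at k b (k + 1) (transpose 0 b c) j))" for j :: "nat \<Rightarrow> 'a"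
  proof -
    have "(\<Sum>b\<in>?B. \<Sum>c\<in>?C. jet_at k b 1 (transpose 0 b c) (j \<circ> transpose 1 (k + 1)))
      = (\<Sum>b\<in>?B. \<Sum>c\<in>?C. jet_at k b (k + 1) (transpose 0 b c) j)"
      by (intro sum.cong[OF HOL.refl] swap)
    note eq = this
    have neq: "1 \<noteq> k + 1" using k by simp
    show ?thesis unfolding symmetrize_two[OF neq] symmetrize_row[OF k] eq ..
  qed
  then have eq: "symmetrize {1, k + 1} (symmetrize ({0, 2} \<union> {3..k}) (T_jet k))
    = (\<lambda>j :: nat \<Rightarrow> 'a. (1 / 2) *\<^sub>R (?c *\<^sub>R (\<Sum>b\<in>?B. \<Sum>c\<in>?C. jet_at k b 1 (transpose 0 b c) j)
      + ?c *\<^sub>R (\<Sum>b\<in>?B. \<Sum>c\<in>?C. jet_at k b (k + 1) (transpose 0 b c) j)))"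
    by (rule ext)
  have "E_T k i = (1 / 2) *\<^sub>R (?c *\<^sub>R (\<Sum>b\<in>?B. \<Sum>c\<in>?C. ?f 1 b (transpose 0 b c))
      + ?c *\<^sub>R (\<Sum>b\<in>?B. \<Sum>c\<in>?C. ?f (k + 1) b (transpose 0 b c)))"
    unfolding E_T_def antisymmetrize_columns_def eq
    by (simp only: antisymmetrize_sum antisymmetrize_scaleR antisymmetrize_add)
  \<comment> \<open>With \<open>k + 1\<close> as second field position, 1 and \<open>k + 2\<close>
    are both derivative positions in the long column.\<close>
  also have "(\<Sum>b\<in>?B. \<Sum>c\<in>?C. ?f (k + 1) b (transpose 0 b c)) = 0"
    using k by (intro sum.neutral ballI antisymmetrize_columns_zero[of k 1 "k + 2"]) (auto simp: transpose_def)
  also have "(\<Sum>b\<in>?B. \<Sum>c\<in>?C. ?f 1 b (transpose 0 b c)) = ?f 1 0 2 + ?f 1 2 0"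
  proof -
    have "(\<Sum>b\<in>{3..k}. \<Sum>c\<in>?C. ?f 1 b (transpose 0 b c)) = 0"
    proof (intro sum.neutral ballI)
      fix b c assume "b \<in> {3..k}" "c \<in> ?C"
      \<comment> \<open>If \<open>c = b\<close>, the short column holds two derivative positions;
        otherwise 0 and \<open>k + 2\<close> in the long column do.\<close>
      then show "?f 1 b (transpose 0 b c) = 0"
        using k antisymmetrize_columns_zero[of k 0 "k + 2" b 1 c i]
          antisymmetrize_columns_zero[of k 2 "k + 1" b 1 0 i]
        by (cases "c = b") auto
    qed
    moreover have "(\<Sum>c\<in>{3..k}. ?f 1 0 (transpose 0 0 c)) = 0"
      using k by (intro sum.neutral ballI antisymmetrize_columns_zero[of k 2 "k + 1"]) auto
    moreover have "(\<Sum>c\<in>{3..k}. ?f 1 2 (transpose 0 2 c)) = 0"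
      using k by (intro sum.neutral ballI antisymmetrize_columns_zero[of k 0 "k + 2"]) (auto simp: transpose_def)
    ultimately show ?thesis by simp
  qed
  also have "\<dots> = (1 / 4) *\<^sub>R
    K_var (image_mset i (mset_set {3..<k + 1})) (i 0) (i 1) (i (k + 2)) (i 2) (i (k + 1))"
    by (simp only: antisymmetrize_columns_K[OF k] flip: scaleR_add_left) simp
  finally show ?thesis by (simp add: mult.assoc)
qed

section \<open>Assembling the homotopy\<close>

lemma K_var_in_span: "K_var M a b c e f \<in> span cohomology_variables"
proof -
  obtain xs where M: "mset xs = M" using ex_mset by blast
  define k where "k = length xs + 2"
  define i where "i n = (if n = 0 then a else if n = 1 then b else if n = 2 then e
    else if n = k + 1 then f else if n = k + 2 then c else xs ! (n - 3))" for n
  have "map i [3..<k + 1] = xs"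
    by (rule nth_equalityI) (simp_all add: k_def i_def del: upt_Suc)
  then have "image_mset i (mset_set {3..<k + 1}) = M"
    using M mset_map[of i "[3..<k + 1]"] by (simp only: mset_upt)
  moreover have k: "k \<ge> 2" by (simp add: k_def)
  ultimately have "E_T k i = (1 / (8 * real k * (real k - 1))) *\<^sub>R K_var M a b c e f"
    unfolding E_T_eq_K[OF k] using k by (simp add: i_def)
  moreover have "8 * real k * (real k - 1) * (1 / (8 * real k * (real k - 1))) = 1"
    using k by simp
  ultimately have "K_var M a b c e f = (8 * real k * (real k - 1)) *\<^sub>R E_T k i"
    by (simp only: scaleR_scaleR scaleR_one)
  moreover have "E_T k i \<in> cohomology_variables"
    using k unfolding cohomology_variables_def by blast
  ultimately show ?thesis by (simp add: span_base span_scale)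
qed

lemma homotopy_cohomology_variables:
  obtains s where "homotopy gamma s (cohomology_variables :: 'n jet_algebra set)"
proof -
  obtain s :: "'n jet_algebra \<Rightarrow> 'n jet_algebra"
    where s: "odd_derivation s" and s_var: "\<And>g. s (var g) = homotopy_var g"
    using odd_derivation_exists[OF index_symmetric_homotopy_var homotopy_var_graded_central] by blast
  interpret s: odd_derivation s by (fact s)
  note linear = s.linear
  have s_X: "s (X_var M a b) = X_homotopy M a b" for M a b
    unfolding X_var_def s.add s.scaleR s_var by (simp add: algebra_simps flip: scaleR_add_left)
  have s_T: "s (T_var M a b c) = 0" for M a b c by (simp add: s_var)
  have s_K: "s (K_var M a b c e f) = 0" for M a b c e f
    by (simp add: K_var_def D_var_def s_T s.add linear_diff[OF linear])
  have s_F: "s (F_A a b c) = 0" for a b c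
  proof -
    have single: "X_homotopy {#d#} x y = (1 / 12) *\<^sub>R T_var {#} d x y" for d x y :: 'n
      by (simp add: X_homotopy_def)
    have "s (F_A a b c) = (1 / 36) *\<^sub>R ((T_var {#} a b c - T_var {#} b a c) +
       (T_var {#} b c a - T_var {#} c b a) + (T_var {#} c a b - T_var {#} a c b))"
      by (simp add: F_var_F_A F_var_def R_var_def s.scaleR s.add linear_diff[OF linear] s_X single algebra_simps)
    also have "\<dots> = (1 / 18) *\<^sub>R (T_var {#} a b c + T_var {#} c a b + T_var {#} b c a)"
      unfolding var_T_antisym[of b a] var_T_antisym[of c b] var_T_antisym[of a c] by (simp add: algebra_simps flip: scaleR_add_left)
    finally show ?thesis by (simp only: var_T_cyclic scaleR_zero_right)
  qed
  have X: "X_var M a b - (gamma (s (X_var M a b)) + s (gamma (X_var M a b))) \<in> span cohomology_variables" for M a b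
  proof (cases "size M = 1")
    case True
    then obtain d where "M = {#d#}" by (metis size_1_singleton_mset)
    then have eq: "gamma (s (X_var M a b)) + s (gamma (X_var M a b))
        = gamma (X_homotopy {#d#} a b) + C_homotopy {#a, d#} b"
      by (simp add: s_X gamma_X_var s_var)
    have "X_var M a b - (gamma (s (X_var M a b)) + s (gamma (X_var M a b))) = (1 / 2) *\<^sub>R F_A d a b"
      unfolding eq using X_homotopy_formula_single[of d a b] by (simp add: \<open>M = _\<close> F_var_F_A)
    moreover have "F_A d a b \<in> cohomology_variables" unfolding cohomology_variables_def by blast
    ultimately show ?thesis by (simp add: span_base span_scale)
  next
    case False
    have eq: "gamma (s (X_var M a b)) + s (gamma (X_var M a b))
        = gamma (X_homotopy M a b) + C_homotopy (add_mset a M) b"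
      by (simp add: s_X gamma_X_var s_var)
    show ?thesis
      unfolding eq using X_homotopy_formula[OF False, of a b] by (simp add: span_zero)
  qed
  have gamma_F_A: "gamma (F_A a b c) = 0" for a b c :: 'n
    by (simp add: F_var_F_A gamma_F_var)
  have antifield: "gamma (var (f, M)) = 0" "s (var (f, M)) = 0" if "is_antifield f" for f :: "'n basic_field" and M
    using that by (cases f; simp add: gamma_gamma_var s_var)+
  let ?p = "\<lambda>x. x - (gamma (s x) + s (gamma x))"
  have p: "linear ?p"
    by (rule linearI) (simp_all add: s.add s.scaleR algebra_simps)
  have anti: "?p (var (f, M)) \<in> span cohomology_variables" if "is_antifield f" for f M
  proof -
    have "var (f, M) \<in> cohomology_variables" using that unfolding cohomology_variables_def by blast
    then show ?thesis using that by (simp add: antifield linear_0[OF linear] span_base)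
  qed
  have "homotopy gamma s cohomology_variables"
  proof (intro homotopy.intro odd_derivation_gamma s homotopy_axioms.intro)
    fix h :: "'n jet_algebra" assume "h \<in> cohomology_variables"
    then consider a where "h = var (GhostC a, {#})" | a b c where "h = F_A a b c"
      | k i where "h = E_T k i" "k \<ge> 2" | f M where "h = var (f, M)" "is_antifield f"
      unfolding cohomology_variables_def by blast
    then have "gamma h = 0 \<and> s h = 0"
      using antifield
      by cases (auto simp: gamma_gamma_var s_var C_homotopy_def F_var_F_A[symmetric] s_F gamma_F_A
          E_T_eq_K gamma_K_var s_K s.scaleR)
    then show "gamma h = 0" "s h = 0" by blast+
  next
    fix g :: "'n jet"
    obtain f M where g: "g = (f, M)" by (cases g)
    show "?p (var g) \<in> span cohomology_variables"
    proof (cases f)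
      case (FieldT a b c)
      then show ?thesis
        using T_homotopy_formula[OF linear s_X subspace_span K_var_in_span, of a b c M] by (simp add: g s_T)
    next
      case (GhostS a b)
      show ?thesis unfolding g GhostS GhostS_eq linear_add[OF p] linear_scale[OF p]
        by (intro span_scale span_add X)
    next
      case (GhostA a b)
      show ?thesis unfolding g GhostA GhostA_eq linear_diff[OF p] by (intro span_diff X)
    next
      case (GhostC b)
      show ?thesis
      proof (cases "M = {#}")
        case True
        have "var (GhostC b, {#}) \<in> cohomology_variables" unfolding cohomology_variables_def by blast
        then show ?thesis
          by (simp add: g GhostC True s_var C_homotopy_def gamma_gamma_var linear_0[OF linear] span_base)
      qed (simp add: g GhostC s_var C_homotopy_formula gamma_gamma_var linear_0[OF linear] span_zero)
    next
      case (Anti3 a b c)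
      then show ?thesis using anti[of f M] by (simp add: g)
    next
      case (Anti2 b c)
      then show ?thesis using anti[of f M] by (simp add: g)
    next
      case (Anti1 c)
      then show ?thesis using anti[of f M] by (simp add: g)
    qed
  qed simp
  then show ?thesis by (rule that)
qed

theorem mainTheorem1:
  shows "(\<forall>x \<in> (cohomology_variables :: 'n::finite jet_algebra set). gamma x = 0) \<and>
    cohomology_class gamma \<in>
      ring_iso (subset_ring (cohomology_polynomials :: 'n jet_algebra set)) (cohomology_ring gamma)"
proof -
  obtain s where s: "homotopy gamma s (cohomology_variables :: 'n jet_algebra set)"
    by (rule homotopy_cohomology_variables)
  then show ?thesis
    using homotopy.d_H[OF s] cohomology_iso_if_homotopy[OF s]
    unfolding cohomology_polynomials_def by blast
qed

end
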